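(* For every prime $p>0$ there exists a complete non-Archimedean field $(k,|\cdot|)$ of characteristic $p$ (with nontrivial value group) such that for every integer $n>0$ the Tate algebra $T_n(k)=k\{X_1,\dots,X_n\}$ admits no nonzero $T_n(k)$-linear map $F_{T_n(k)*}T_n(k)\to T_n(k)$. In particular, $T_n(k)$ is not Frobenius split for any $n>0$.
   Context: A non-Archimedean field $(k,|\cdot|)$ is a field $k$ with a map $|\cdot|\colon k\to\mathbb{R}_{\ge0}$ such that $|x|=0$ iff $x=0$, $|x+y|\le\max\{|x|,|y|\}$, $|xy|=|x||y|$; here it is assumed complete for the metric $|x-y|$ and with value group $|k^\times|\neq\{1\}$. The Tate algebra $T_n(k)=k\{X_1,\dots,X_n\}$ is the subring of $k[[X_1,\dots,X_n]]$ consisting of series $\sum_{\nu\in\mathbb{Z}_{\ge0}^n}a_\nu X^\nu$ with $|a_\nu|\to0$ as $\nu_1+\dots+\nu_n\to\infty$. For a ring $R$ of characteristic $p$, $F_{R*}R$ denotes $R$ viewed as an $R$-module via $r\cdot x=r^px$; an $R$-linear map $F_{R*}R\to R$ is called a $p^{-1}$-linear map, and $R$ is Frobenius split if there is a $p^{-1}$-linear map sending $1$ to $1$. *)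

theory Defs
  imports Complex_Main "HOL-Computational_Algebra.Primes" "HOL-Algebra.Ring"
begin

definition ring_char_is :: "('a, 'b) ring_scheme \<Rightarrow> nat \<Rightarrow> bool" where
  "ring_char_is R p \<longleftrightarrow> 0 < p \<and> add_pow R p \<one>\<^bsub>R\<^esub> = \<zero>\<^bsub>R\<^esub> \<and>
     (\<forall>m. 0 < m \<and> m < p \<longrightarrow> add_pow R m \<one>\<^bsub>R\<^esub> \<noteq> \<zero>\<^bsub>R\<^esub>)"

definition nonarch_abs :: "('a, 'b) ring_scheme \<Rightarrow> ('a \<Rightarrow> real) \<Rightarrow> bool" where
  "nonarch_abs R v \<longleftrightarrow>
     (\<forall>x\<in>carrier R. v x \<ge> 0) \<and>
     (\<forall>x\<in>carrier R. v x = 0 \<longleftrightarrow> x = \<zero>\<^bsub>R\<^esub>) \<and>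
     (\<forall>x\<in>carrier R. \<forall>y\<in>carrier R. v (x \<oplus>\<^bsub>R\<^esub> y) \<le> max (v x) (v y)) \<and>
     (\<forall>x\<in>carrier R. \<forall>y\<in>carrier R. v (x \<otimes>\<^bsub>R\<^esub> y) = v x * v y)"

definition abs_complete :: "('a, 'b) ring_scheme \<Rightarrow> ('a \<Rightarrow> real) \<Rightarrow> bool" where
  "abs_complete R v \<longleftrightarrow>
     (\<forall>s :: nat \<Rightarrow> 'a. (\<forall>i. s i \<in> carrier R) \<and>
          (\<forall>e>0. \<exists>N. \<forall>i\<ge>N. \<forall>j\<ge>N. v (a_minus R (s i) (s j)) < e)
        \<longrightarrow> (\<exists>l\<in>carrier R. \<forall>e>0. \<exists>N. \<forall>i\<ge>N. v (a_minus R (s i) l) < e))"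

definition abs_nontrivial :: "('a, 'b) ring_scheme \<Rightarrow> ('a \<Rightarrow> real) \<Rightarrow> bool" where
  "abs_nontrivial R v \<longleftrightarrow> (\<exists>x\<in>carrier R. x \<noteq> \<zero>\<^bsub>R\<^esub> \<and> v x \<noteq> 1)"

definition complete_nonarch_field :: "('a, 'b) ring_scheme \<Rightarrow> ('a \<Rightarrow> real) \<Rightarrow> bool" where
  "complete_nonarch_field R v \<longleftrightarrow>
     field R \<and> nonarch_abs R v \<and> abs_complete R v \<and> abs_nontrivial R v"

text \<open>Tate algebra T_n(k). Multi-indices in N^n are lists of length n; a series
  is its coefficient function (coefficients outside N^n are set to 0).\<close>
definition tate_carrier :: "('a, 'b) ring_scheme \<Rightarrow> ('a \<Rightarrow> real) \<Rightarrow> nat \<Rightarrow> (nat list \<Rightarrow> 'a) set" where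
  "tate_carrier R v n = {a.
     (\<forall>\<nu>. a \<nu> \<in> carrier R) \<and>
     (\<forall>\<nu>. length \<nu> \<noteq> n \<longrightarrow> a \<nu> = \<zero>\<^bsub>R\<^esub>) \<and>
     (\<forall>e>0. \<exists>N. \<forall>\<nu>. length \<nu> = n \<and> sum_list \<nu> \<ge> N \<longrightarrow> v (a \<nu>) < e)}"

definition tate :: "('a, 'b) ring_scheme \<Rightarrow> ('a \<Rightarrow> real) \<Rightarrow> nat \<Rightarrow> (nat list \<Rightarrow> 'a) ring" where
  "tate R v n = \<lparr>
     carrier = tate_carrier R v n,
     mult = (\<lambda>a b \<nu>. finsum R (\<lambda>(\<mu>, \<mu>'). a \<mu> \<otimes>\<^bsub>R\<^esub> b \<mu>')
                 {(\<mu>, \<mu>'). length \<mu> = n \<and> length \<mu>' = n \<and> map2 (+) \<mu> \<mu>' = \<nu>}),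
     one = (\<lambda>\<nu>. if \<nu> = replicate n 0 then \<one>\<^bsub>R\<^esub> else \<zero>\<^bsub>R\<^esub>),
     zero = (\<lambda>\<nu>. \<zero>\<^bsub>R\<^esub>),
     add = (\<lambda>a b \<nu>. a \<nu> \<oplus>\<^bsub>R\<^esub> b \<nu>) \<rparr>"

text \<open>A p^{-1}-linear map on a ring A of characteristic p: an A-linear map F_* A \<rightarrow> A,
  i.e. additive and phi (r^p x) = r phi(x).\<close>
definition p_inv_linear :: "('c, 'd) ring_scheme \<Rightarrow> nat \<Rightarrow> ('c \<Rightarrow> 'c) \<Rightarrow> bool" where
  "p_inv_linear A p \<phi> \<longleftrightarrow>
     (\<forall>x\<in>carrier A. \<phi> x \<in> carrier A) \<and>
     (\<forall>x\<in>carrier A. \<forall>y\<in>carrier A. \<phi> (x \<oplus>\<^bsub>A\<^esub> y) = \<phi> x \<oplus>\<^bsub>A\<^esub> \<phi> y) \<and>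
     (\<forall>r\<in>carrier A. \<forall>x\<in>carrier A. \<phi> ((r [^]\<^bsub>A\<^esub> p) \<otimes>\<^bsub>A\<^esub> x) = r \<otimes>\<^bsub>A\<^esub> \<phi> x)"

definition frobenius_split :: "('c, 'd) ring_scheme \<Rightarrow> nat \<Rightarrow> bool" where
  "frobenius_split A p \<longleftrightarrow> (\<exists>\<phi>. p_inv_linear A p \<phi> \<and> \<phi> \<one>\<^bsub>A\<^esub> = \<one>\<^bsub>A\<^esub>)"

end

theory Submission
  imports Defs "HOL-Library.Countable" "HOL-Library.Infinite_Set"
begin

text \<open>
  Let \<open>\<Gamma>\<close> be the multiplicative group of positive rationals and consider Hahn series over the field
  with \<open>p\<close> elements and exponents in \<open>\<Gamma>\<close>, the supports being reverse well-ordered and the absolute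
  value of a series being the largest element of its support. The field \<open>k\<close> consists of the series
  whose support, above each positive bound, meets only finitely many cosets of \<open>\<Gamma>\<^sup>p\<close>. It is complete,
  but not spherically complete: the partial sums of the monomials with exponents \<open>1 + 1 / q\<close>, \<open>q\<close> an odd
  prime, have no pseudo-limit in \<open>k\<close>. On the other hand the series with support in \<open>\<Gamma>\<^sup>p\<close> form a
  spherically complete field \<open>L\<close> with \<open>k\<^sup>p \<subseteq> L \<subseteq> k\<close>. A continuous \<open>p\<^bsup>-1\<^esup>\<close>-linear map \<open>k \<rightarrow> k\<close> is zero
  on each \<open>x L\<close>, since otherwise its image \<open>k\<close> would be spherically complete. Finally, the coefficients
  of a \<open>p\<^bsup>-1\<^esup>\<close>-linear map on a Tate algebra over \<open>k\<close> are automatically continuous on \<open>k X\<^sup>e\<close>, hence zero.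
\<close>

section \<open>Hahn series with integer coefficients\<close>

text \<open>The exponent group \<Gamma> serves three purposes: its elements are dense in the
  positive reals, so that scalars can be rescaled almost at will; it is countable, so that a series
  can be coded by a set of reals; and it has infinitely many cosets modulo p-th powers, which leaves
  room for series outside \<open>k\<close>. Coefficients are integers because p is a variable: one
  ring serves all primes, and the series over the field with p elements are the fixed points of
  reducing coefficients modulo p. Since |\<phi>(r^p a)| = |r| |\<phi>(a)|, sizes have to be compared
  through the quotients |\<phi>(a)|^p / |a|, which do not change when a is multiplied by r^p. Their
  supremum on \<open>L\<close> need not be attained, so images can only be lifted with norms close
  to optimal; the strict decrease of the values 1 + 1 / q absorbs that loss. Only odd q are taken
  because 2 and 3 are primes that differ by 1, and the valuation argument needs r not to divide q +
  1. As 1 lies in \<open>L\<close>, every x lies in \<open>x L\<close>, so vanishing on all these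
  subspaces is vanishing on \<open>k\<close>.\<close>

text \<open>Reverse well-ordered sets of positive rationals.\<close>

definition rwo :: "rat set \<Rightarrow> bool" where
  "rwo S \<longleftrightarrow> S \<subseteq> {0<..} \<and> (\<forall>T\<subseteq>S. T \<noteq> {} \<longrightarrow> (\<exists>m\<in>T. \<forall>x\<in>T. x \<le> m))"

lemma rwoD: "rwo S \<Longrightarrow> T \<subseteq> S \<Longrightarrow> T \<noteq> {} \<Longrightarrow> \<exists>m\<in>T. \<forall>x\<in>T. x \<le> m"
  by (auto simp: rwo_def)

lemma rwo_pos: "rwo S \<Longrightarrow> x \<in> S \<Longrightarrow> 0 < x"
  by (auto simp: rwo_def)

lemma rwo_subset: "rwo S \<Longrightarrow> T \<subseteq> S \<Longrightarrow> rwo T"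
  unfolding rwo_def by blast

lemma rwo_Un:
  assumes "rwo A" "rwo B" shows "rwo (A \<union> B)"
  unfolding rwo_def
proof (intro conjI allI impI)
  show "A \<union> B \<subseteq> {0<..}" using assms by (auto simp: rwo_def)
  fix T assume T: "T \<subseteq> A \<union> B" "T \<noteq> {}"
  show "\<exists>m\<in>T. \<forall>x\<in>T. x \<le> m"
  proof (cases "T \<inter> A = {} \<or> T \<inter> B = {}")
    case True
    then have "T \<subseteq> A \<or> T \<subseteq> B" using T by blast
    then show ?thesis using assms T rwoD by blast
  next
    case False
    then obtain m n where mn: "m \<in> T \<inter> A" "\<forall>x\<in>T \<inter> A. x \<le> m"
        "n \<in> T \<inter> B" "\<forall>x\<in>T \<inter> B. x \<le> n"
      by (meson assms inf_le2 rwoD)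
    have "x \<le> max m n" if "x \<in> T" for x
      using mn T(1) that by (cases "x \<in> A") (auto simp: le_max_iff_disj)
    moreover have "max m n \<in> T" using mn by (simp add: max_def)
    ultimately show ?thesis by blast
  qed
qed

lemma rwo_finite:
  assumes "finite S" "S \<subseteq> {0<..}" shows "rwo S"
  unfolding rwo_def
proof (intro conjI allI impI)
  fix T assume "T \<subseteq> S" "T \<noteq> {}"
  then show "\<exists>m\<in>T. \<forall>x\<in>T. x \<le> m"
    using assms finite_subset[of T S] by (intro bexI[of _ "Max T"]) auto
qed (use assms in auto)

text \<open>A nonempty set has the same maximum as its part above any one of its members. Series
  defined as coefficientwise limits get their well-ordered support from this.\<close>

lemma rwo_locally:
  assumes "S \<subseteq> {0<..}" "\<And>c. c \<in> S \<Longrightarrow> rwo (S \<inter> {c..})"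
  shows "rwo S"
  unfolding rwo_def
proof (intro conjI allI impI)
  fix T assume T: "T \<subseteq> S" "T \<noteq> {}"
  then obtain c where c: "c \<in> T" by blast
  have "rwo (S \<inter> {c..})" using assms(2) c T by blast
  from rwoD[OF this, of "T \<inter> {c..}"] obtain m where "m \<in> T \<inter> {c..}" "\<forall>x\<in>T \<inter> {c..}. x \<le> m"
    using T c by auto
  then show "\<exists>m\<in>T. \<forall>x\<in>T. x \<le> m" by (intro bexI[of _ m]) force+
qed (use assms in auto)

lemma rwo_incseq_stationary:
  assumes "rwo S" "incseq s" "\<And>n. s n \<in> S"
  shows "\<exists>N. \<forall>n\<ge>N. s n = s N"
proof -
  obtain m where "m \<in> range s" "\<forall>x\<in>range s. x \<le> m"
    using rwoD[OF assms(1), of "range s"] assms(3) by blast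
  then obtain N where "\<forall>n. s n \<le> s N" by auto
  then show ?thesis using assms(2) by (metis incseq_def order_antisym)
qed

lemma rwo_no_strict_mono:
  fixes s :: "nat \<Rightarrow> rat"
  assumes "rwo S" "strict_mono s" shows "\<exists>n. s n \<notin> S"
proof (rule ccontr)
  assume "\<not> ?thesis"
  then obtain N where N: "\<forall>n\<ge>N. s n = s N"
    using rwo_incseq_stationary[OF assms(1), of s] assms(2) by (auto simp: strict_mono_mono)
  have "s (Suc N) = s N" by (rule N[rule_format]) simp
  then show False using assms(2) by (simp add: strict_mono_eq)
qed

text \<open>A set of products without maximum contains a strictly increasing sequence. On a
  subsequence the first factors are monotone, hence eventually nonincreasing, because
  \<open>A\<close> has no strictly increasing sequence; the second factors then increase strictly
  inside \<open>B\<close>, which is impossible.\<close>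

lemma rwo_mult:
  assumes A: "rwo A" and B: "rwo B" shows "rwo {a * b |a b. a \<in> A \<and> b \<in> B}" (is "rwo ?P")
  unfolding rwo_def
proof (intro conjI allI impI)
  show "?P \<subseteq> {0<..}" using rwo_pos[OF A] rwo_pos[OF B] by auto
  fix T assume T: "T \<subseteq> ?P" "T \<noteq> {}"
  show "\<exists>m\<in>T. \<forall>x\<in>T. x \<le> m"
  proof (rule ccontr)
    assume "\<not> ?thesis"
    then have nomax: "\<forall>m\<in>T. \<exists>x\<in>T. m < x" by force
    have "\<exists>c. \<forall>n::nat. c n \<in> T \<and> c n < c (Suc n)"
      by (rule dependent_nat_choice) (use T nomax in auto)
    then obtain c :: "nat \<Rightarrow> rat" where c: "\<And>n. c n \<in> T" "\<And>n. c n < c (Suc n)" by blast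
    then have mono: "strict_mono c" by (simp add: strict_mono_Suc_iff)
    have "\<forall>n. \<exists>ab. fst ab \<in> A \<and> snd ab \<in> B \<and> c n = fst ab * snd ab" using c(1) T(1) by fastforce
    then obtain ab where ab: "\<And>n. fst (ab n) \<in> A" "\<And>n. snd (ab n) \<in> B" "\<And>n. c n = fst (ab n) * snd (ab n)"
      by metis
    obtain r :: "nat \<Rightarrow> nat" where r: "strict_mono r" "monoseq (\<lambda>n. fst (ab (r n)))"
      using seq_monosub[of "\<lambda>n. fst (ab n)"] by blast
    have step: "snd (ab (r m)) < snd (ab (r n))"
      if "m < n" "fst (ab (r n)) \<le> fst (ab (r m))" for m n
    proof (rule ccontr)
      assume "\<not> ?thesis"
      then have "c (r n) \<le> c (r m)"
        unfolding ab(3) using that ab rwo_pos[OF A] rwo_pos[OF B]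
        by (intro mult_mono) (auto simp: less_imp_le)
      then show False using mono r(1) that(1) by (metis leD strict_mono_less)
    qed
    \<comment> \<open>A nondecreasing sequence in \<open>A\<close> is stationary from some
      \<open>N\<close> on; a nonincreasing one qualifies from 0.\<close>
    obtain N where N: "\<And>m n. N \<le> m \<Longrightarrow> m \<le> n \<Longrightarrow> fst (ab (r n)) \<le> fst (ab (r m))"
    proof (cases "incseq (\<lambda>n. fst (ab (r n)))")
      case True
      from rwo_incseq_stationary[OF A this] ab(1) obtain N
        where "\<forall>n\<ge>N. fst (ab (r n)) = fst (ab (r N))" by blast
      then show ?thesis by (intro that[of N]) (metis order_refl order_trans)
    next
      case False
      then have "decseq (\<lambda>n. fst (ab (r n)))" using r(2) by (simp add: monoseq_iff)
      then show ?thesis by (intro that[of 0]) (auto simp: decseq_def)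
    qed
    have "strict_mono (\<lambda>n. snd (ab (r (N + n))))"
      unfolding strict_mono_Suc_iff by (auto intro!: step N)
    from rwo_no_strict_mono[OF B this] ab(2) show False by blast
  qed
qed

text \<open>Infinitely many factorizations would give an injective monotone sequence of first
  factors. It cannot increase inside \<open>A\<close>, and if it decreases, the cofactors
  \<open>q / a\<close> increase strictly inside \<open>B\<close>. This makes the coefficients of a
  product finite sums.\<close>

lemma rwo_finite_factorizations:
  assumes A: "rwo A" and B: "rwo B" shows "finite {a \<in> A. q / a \<in> B}"
proof (rule ccontr)
  assume "infinite {a \<in> A. q / a \<in> B}" (is "infinite ?S")
  then obtain s :: "nat \<Rightarrow> rat" where s: "inj s" "range s \<subseteq> ?S"
    using infinite_countable_subset by blast
  obtain r :: "nat \<Rightarrow> nat" where r: "strict_mono r" "monoseq (\<lambda>n. s (r n))"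
    using seq_monosub[of s] by blast
  have inj: "s (r m) \<noteq> s (r n)" if "m < n" for m n
    using s(1) r(1) that by (metis injD less_irrefl strict_mono_less)
  have pos: "0 < s (r n)" and inA: "s (r n) \<in> A" and inB: "q / s (r n) \<in> B" for n
    using s(2) rwo_pos[OF A] by auto
  then have q: "0 < q" using rwo_pos[OF B] by (metis divide_pos_pos less_asym not_less_iff_gr_or_eq zero_less_divide_iff)
  show False
  proof (cases "incseq (\<lambda>n. s (r n))")
    case True
    then show False using rwo_incseq_stationary[OF A True] inA inj by (metis le_add2 lessI plus_1_eq_Suc)
  next
    case False
    then have "decseq (\<lambda>n. s (r n))" using r(2) by (simp add: monoseq_iff)
    then have "s (r (Suc n)) < s (r n)" for n using inj[of n "Suc n"] by (simp add: decseq_Suc_iff order_less_le)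
    then have "strict_mono (\<lambda>n. q / s (r n))"
      unfolding strict_mono_Suc_iff using q pos by (auto intro!: divide_strict_left_mono)
    then show False using rwo_no_strict_mono[OF B] inB by blast
  qed
qed

section \<open>Hahn series over the integers as a commutative ring\<close>

typedef hahn = "{f :: rat \<Rightarrow> int. rwo {q. f q \<noteq> 0}}"
  morphisms coeff Abs_hahn
  by (rule exI[of _ "\<lambda>_. 0"]) (simp add: rwo_def)

definition supp :: "hahn \<Rightarrow> rat set" where
  "supp x = {q. coeff x q \<noteq> 0}"

lemma rwo_supp: "rwo (supp x)"
  using coeff[of x] by (simp add: supp_def)

lemma in_supp_iff: "q \<in> supp x \<longleftrightarrow> coeff x q \<noteq> 0"
  by (simp add: supp_def)

lemma supp_pos: "q \<in> supp x \<Longrightarrow> 0 < q"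
  using rwo_supp rwo_pos by blast

lemma hahn_eqI: "(\<And>q. coeff x q = coeff y q) \<Longrightarrow> x = y"
  by (simp add: coeff_inject[symmetric] ext)

lemma hahn_eq_iff: "x = y \<longleftrightarrow> (\<forall>q. coeff x q = coeff y q)"
  using hahn_eqI by blast

lemma coeff_Abs_hahn: "rwo S \<Longrightarrow> (\<And>q. f q \<noteq> 0 \<Longrightarrow> q \<in> S) \<Longrightarrow> coeff (Abs_hahn f) = f"
  by (rule Abs_hahn_inverse) (auto intro: rwo_subset)

text \<open>The monomial with exponent \<open>q\<close> has absolute value \<open>q\<close>, so exponents multiply.\<close>

definition pairs :: "hahn \<Rightarrow> hahn \<Rightarrow> rat \<Rightarrow> (rat \<times> rat) set" where
  "pairs x y q = {(a, b). a \<in> supp x \<and> b \<in> supp y \<and> a * b = q}"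

lemma finite_mult_pairs:
  assumes "rwo A" "rwo B"
  shows "finite {(a, b). a \<in> A \<and> b \<in> B \<and> a * b = q}"
proof (rule finite_subset)
  show "{(a, b). a \<in> A \<and> b \<in> B \<and> a * b = q} \<subseteq> (\<lambda>a. (a, q / a)) ` {a \<in> A. q / a \<in> B}"
    using rwo_pos[OF assms(1)] rwo_pos[OF assms(2)] by (force simp: image_iff)
qed (use rwo_finite_factorizations[OF assms] in auto)

lemma finite_pairs: "finite (pairs x y q)"
  unfolding pairs_def by (rule finite_mult_pairs) (rule rwo_supp)+

definition supp_mult :: "hahn \<Rightarrow> hahn \<Rightarrow> rat set" where
  "supp_mult x y = {a * b |a b. a \<in> supp x \<and> b \<in> supp y}"

lemma rwo_supp_mult: "rwo (supp_mult x y)"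
  unfolding supp_mult_def by (intro rwo_mult rwo_supp)

instantiation hahn :: comm_ring_1
begin

definition zero_hahn :: hahn where "0 = Abs_hahn (\<lambda>_. 0)"
definition one_hahn :: hahn where "1 = Abs_hahn (\<lambda>q. if q = 1 then 1 else 0)"
definition plus_hahn :: "hahn \<Rightarrow> hahn \<Rightarrow> hahn" where
  "x + y = Abs_hahn (\<lambda>q. coeff x q + coeff y q)"
definition minus_hahn :: "hahn \<Rightarrow> hahn \<Rightarrow> hahn" where
  "x - y = Abs_hahn (\<lambda>q. coeff x q - coeff y q)"
definition uminus_hahn :: "hahn \<Rightarrow> hahn" where
  "- x = Abs_hahn (\<lambda>q. - coeff x q)"
definition times_hahn :: "hahn \<Rightarrow> hahn \<Rightarrow> hahn" where
  "x * y = Abs_hahn (\<lambda>q. \<Sum>(a, b)\<in>pairs x y q. coeff x a * coeff y b)"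

lemma coeff_0 [simp]: "coeff 0 q = 0"
  unfolding zero_hahn_def by (subst coeff_Abs_hahn[of "{}"]) (auto simp: rwo_def)

lemma coeff_1: "coeff 1 q = (if q = 1 then 1 else 0)"
  unfolding one_hahn_def by (subst coeff_Abs_hahn[of "{1}"]) (auto simp: rwo_finite split: if_splits)

lemma coeff_add [simp]: "coeff (x + y) q = coeff x q + coeff y q"
  unfolding plus_hahn_def
  by (subst coeff_Abs_hahn[of "supp x \<union> supp y"]) (auto simp: in_supp_iff intro: rwo_Un rwo_supp)

lemma coeff_diff [simp]: "coeff (x - y) q = coeff x q - coeff y q"
  unfolding minus_hahn_def
  by (subst coeff_Abs_hahn[of "supp x \<union> supp y"]) (auto simp: in_supp_iff intro: rwo_Un rwo_supp)

lemma coeff_uminus [simp]: "coeff (- x) q = - coeff x q"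
  unfolding uminus_hahn_def
  by (subst coeff_Abs_hahn[of "supp x"]) (auto simp: in_supp_iff intro: rwo_supp)

lemma coeff_mult: "coeff (x * y) q = (\<Sum>(a, b)\<in>pairs x y q. coeff x a * coeff y b)"
  unfolding times_hahn_def
proof (subst coeff_Abs_hahn[OF rwo_supp_mult[of x y]])
  fix q assume "(\<Sum>(a, b)\<in>pairs x y q. coeff x a * coeff y b) \<noteq> 0"
  then have "pairs x y q \<noteq> {}" by (metis sum.empty)
  then show "q \<in> supp_mult x y" by (auto simp: pairs_def supp_mult_def)
qed simp

lemma supp_mult_subset: "supp (x * y) \<subseteq> supp_mult x y"
proof
  fix q assume "q \<in> supp (x * y)"
  then have "pairs x y q \<noteq> {}" by (metis coeff_mult in_supp_iff sum.empty)
  then show "q \<in> supp_mult x y" by (auto simp: pairs_def supp_mult_def)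
qed

text \<open>Supports shrink under cancellation, so comparing several products needs one index set
  for all of them; enlarging the set of factorizations only adds zero terms.\<close>

lemma coeff_mult_superset:
  assumes "finite S" "\<And>a b. coeff x a \<noteq> 0 \<Longrightarrow> coeff y b \<noteq> 0 \<Longrightarrow> a * b = q \<Longrightarrow> (a, b) \<in> S"
    and "\<And>a b. (a, b) \<in> S \<Longrightarrow> a * b = q"
  shows "coeff (x * y) q = (\<Sum>(a, b)\<in>S. coeff x a * coeff y b)"
  unfolding coeff_mult
  by (rule sum.mono_neutral_left) (use assms in \<open>auto simp: pairs_def in_supp_iff\<close>)

text \<open>A sum over triples in which the three factors play equal roles, so that associativity
  follows from a cyclic relabelling together with commutativity. The intermediate exponent ranges
  over \<open>supp_mult x y\<close>, so that every triple is indexed even where coefficients of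
  \<open>x * y\<close> cancel.\<close>

lemma coeff_mult_assoc:
  "coeff ((x * y) * z) q =
    (\<Sum>(a, b, c)\<in>{(a, b, c). a \<in> supp x \<and> b \<in> supp y \<and> c \<in> supp z \<and> a * b * c = q}.
      coeff x a * coeff y b * coeff z c)"
proof -
  define Q where "Q = {(d, c). d \<in> supp_mult x y \<and> c \<in> supp z \<and> d * c = q}"
  have fin: "finite Q" unfolding Q_def by (rule finite_mult_pairs) (rule rwo_supp_mult rwo_supp)+
  have "coeff ((x * y) * z) q = (\<Sum>(d, c)\<in>Q. coeff (x * y) d * coeff z c)"
    by (rule coeff_mult_superset[OF fin]) (use supp_mult_subset[of x y] in \<open>auto simp: Q_def in_supp_iff\<close>)
  also have "\<dots> = (\<Sum>dc\<in>Q. \<Sum>ab\<in>pairs x y (fst dc). coeff x (fst ab) * coeff y (snd ab) * coeff z (snd dc))"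
    by (intro sum.cong) (auto simp: coeff_mult sum_distrib_right case_prod_unfold)
  also have "\<dots> = (\<Sum>(dc, ab)\<in>Sigma Q (\<lambda>dc. pairs x y (fst dc)). coeff x (fst ab) * coeff y (snd ab) * coeff z (snd dc))"
    by (rule sum.Sigma) (auto simp: fin finite_pairs)
  also have "\<dots> = (\<Sum>(a, b, c)\<in>{(a, b, c). a \<in> supp x \<and> b \<in> supp y \<and> c \<in> supp z \<and> a * b * c = q}.
      coeff x a * coeff y b * coeff z c)"
    by (rule sum.reindex_bij_witness[where i = "\<lambda>(a, b, c). ((a * b, c), (a, b))"
          and j = "\<lambda>((d, c), (a, b)). (a, b, c)"])
       (auto simp: Q_def pairs_def supp_mult_def)
  finally show ?thesis .
qed

instance
proof
  fix x y z :: hahn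
  show comm: "x * y = y * x" for x y :: hahn
  proof (rule hahn_eqI)
    fix q show "coeff (x * y) q = coeff (y * x) q"
      unfolding coeff_mult
      by (rule sum.reindex_bij_witness[where i = "\<lambda>(a, b). (b, a)" and j = "\<lambda>(a, b). (b, a)"])
         (auto simp: pairs_def mult.commute)
  qed
  show "x * y * z = x * (y * z)"
  proof (rule hahn_eqI)
    fix q
    have "coeff (y * z * x) q = coeff (x * y * z) q"
      unfolding coeff_mult_assoc
      by (rule sum.reindex_bij_witness[where i = "\<lambda>(a, b, c). (b, c, a)" and j = "\<lambda>(b, c, a). (a, b, c)"])
         (auto simp: mult_ac)
    then show "coeff (x * y * z) q = coeff (x * (y * z)) q" by (simp add: comm)
  qed
  show "1 * x = x"
  proof (rule hahn_eqI)
    fix q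
    show "coeff (1 * x) q = coeff x q"
      by (subst coeff_mult_superset[of "{(1, q)}"]) (auto simp: coeff_1 split: if_splits)
  qed
  show "(x + y) * z = x * z + y * z"
  proof (rule hahn_eqI)
    fix q
    define S where "S = pairs x z q \<union> pairs y z q"
    have S: "finite S" "\<And>a b. (a, b) \<in> S \<Longrightarrow> a * b = q" by (auto simp: S_def finite_pairs) (auto simp: pairs_def)
    show "coeff ((x + y) * z) q = coeff (x * z + y * z) q"
      unfolding coeff_add
      by (subst (1 2 3) coeff_mult_superset[OF S(1) _ S(2)])
         (auto simp: S_def pairs_def in_supp_iff case_prod_unfold algebra_simps simp flip: sum.distrib)
  qed
  show "(0::hahn) \<noteq> 1" by (metis coeff_0 coeff_1 zero_neq_one)
qed (auto intro!: hahn_eqI)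

end

lemma coeff_sum: "coeff (sum f A) q = (\<Sum>i\<in>A. coeff (f i) q)"
  by (induction A rule: infinite_finite_induct) auto

section \<open>Monomials and the Frobenius map modulo p\<close>

definition monom :: "int \<Rightarrow> rat \<Rightarrow> hahn" where
  "monom c q = Abs_hahn (\<lambda>r. if r = q \<and> 0 < q then c else 0)"

lemma coeff_monom: "0 < q \<Longrightarrow> coeff (monom c q) r = (if r = q then c else 0)"
  unfolding monom_def by (subst coeff_Abs_hahn[of "{q}"]) (auto simp: rwo_finite split: if_splits)

lemma coeff_monom_mult: "0 < q \<Longrightarrow> coeff (monom c q * x) r = c * coeff x (r / q)"
  by (subst coeff_mult_superset[of "{(q, r / q)}"]) (auto simp: coeff_monom split: if_splits)

lemma monom_mult: "0 < q \<Longrightarrow> 0 < r \<Longrightarrow> monom c q * monom d r = monom (c * d) (q * r)"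
  by (rule hahn_eqI) (auto simp: coeff_monom_mult coeff_monom field_simps)

lemma monom_power: "0 < q \<Longrightarrow> monom c q ^ n = monom (c ^ n) (q ^ n)"
  by (induction n) (auto simp: monom_mult intro!: hahn_eqI simp: coeff_monom coeff_1)

text \<open>The prime divides every binomial coefficient strictly between the ends. The error is
  kept as an explicit multiple of \<open>p\<close> because the ring of Hahn series used here has
  integer coefficients and no characteristic.\<close>

lemma freshmans_dream_mod:
  fixes x y :: "'a::comm_ring_1"
  assumes p: "prime (p::nat)"
  shows "\<exists>z. (x + y) ^ p = x ^ p + y ^ p + of_nat p * z"
proof -
  have p2: "2 \<le> p" using p by (rule prime_ge_2_nat)
  define t where "t k = of_nat (p choose k) * x ^ k * y ^ (p - k)" for k
  define z where "z = (\<Sum>k\<in>{0<..<p}. of_nat ((p choose k) div p) * x ^ k * y ^ (p - k))"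
  have "t k = of_nat p * (of_nat ((p choose k) div p) * x ^ k * y ^ (p - k))" if "k \<in> {0<..<p}" for k
  proof -
    have "p dvd (p choose k)" using that p by (intro dvd_choose_prime) auto
    then have "(p choose k) = p * ((p choose k) div p)" by simp
    then have "of_nat (p choose k) = (of_nat p * of_nat ((p choose k) div p) :: 'a)" by (metis of_nat_mult)
    then show ?thesis by (simp add: t_def mult_ac)
  qed
  then have z: "sum t {0<..<p} = of_nat p * z" by (simp add: z_def sum_distrib_left)
  have "(x + y) ^ p = sum t {..p}" by (simp add: binomial_ring t_def)
  also have "{..p} = insert 0 (insert p {0<..<p})" using p2 by auto
  also have "sum t \<dots> = t 0 + (t p + sum t {0<..<p})" using p2 by (subst sum.insert, auto)+
  also have "\<dots> = x ^ p + y ^ p + of_nat p * z" unfolding z by (simp add: t_def)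
  finally show ?thesis by blast
qed

lemma freshmans_dream_sum_mod:
  fixes f :: "'b \<Rightarrow> 'a::comm_ring_1"
  assumes p: "prime (p::nat)" and "finite F"
  shows "\<exists>z. sum f F ^ p = (\<Sum>i\<in>F. f i ^ p) + of_nat p * z"
  using assms(2)
proof (induction F rule: finite_induct)
  case empty
  then show ?case using prime_gt_0_nat[OF p] by (auto intro!: exI[of _ 0] simp: power_0_left)
next
  case (insert a F)
  then obtain z where z: "sum f F ^ p = (\<Sum>i\<in>F. f i ^ p) + of_nat p * z" by blast
  obtain z' where z': "(f a + sum f F) ^ p = f a ^ p + sum f F ^ p + of_nat p * z'"
    using freshmans_dream_mod[OF p] by blast
  show ?case using insert by (intro exI[of _ "z + z'"]) (simp add: z z' algebra_simps)
qed

lemma coeff_of_nat_mult: "coeff (of_nat n * x) q = int n * coeff x q"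
  by (induction n) (auto simp: algebra_simps)

text \<open>Limits and pseudo-limits are built as coefficient functions that agree, above any point
  of their support, with some existing series; by \<open>rwo_locally\<close> this suffices for being
  a series.\<close>

lemma coeff_Abs_hahn_locally:
  assumes "\<And>q. q \<le> 0 \<Longrightarrow> f q = 0" "\<And>c. f c \<noteq> 0 \<Longrightarrow> \<exists>x. \<forall>q\<ge>c. f q = coeff x q"
  shows "coeff (Abs_hahn f) = f"
proof (rule coeff_Abs_hahn[of "{q. f q \<noteq> 0}"])
  show "rwo {q. f q \<noteq> 0}"
  proof (rule rwo_locally)
    show "{q. f q \<noteq> 0} \<subseteq> {0<..}" using assms(1) by (auto simp: not_less[symmetric])
    fix c assume "c \<in> {q. f q \<noteq> 0}"
    then obtain x where "\<forall>q\<ge>c. f q = coeff x q" using assms(2) by blast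
    then have "{q. f q \<noteq> 0} \<inter> {c..} \<subseteq> supp x" by (auto simp: in_supp_iff)
    then show "rwo ({q. f q \<noteq> 0} \<inter> {c..})" using rwo_supp rwo_subset by blast
  qed
qed auto

definition trunc :: "rat set \<Rightarrow> hahn \<Rightarrow> hahn" where
  "trunc F x = Abs_hahn (\<lambda>q. if q \<in> F then coeff x q else 0)"

lemma coeff_trunc: "coeff (trunc F x) q = (if q \<in> F then coeff x q else 0)"
  unfolding trunc_def by (subst coeff_Abs_hahn[OF rwo_supp[of x]]) (auto simp: in_supp_iff split: if_splits)

text \<open>These are the \<open>n\<close>-fold products of elements of \<open>S\<close>, not its
  subsets; they bound the support of an \<open>n\<close>-th power.\<close>

fun power_set :: "rat set \<Rightarrow> nat \<Rightarrow> rat set" where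
  "power_set S 0 = {1}"
| "power_set S (Suc n) = {a * b |a b. a \<in> S \<and> b \<in> power_set S n}"

lemma rwo_power_set: "rwo S \<Longrightarrow> rwo (power_set S n)"
  by (induction n) (auto intro: rwo_finite rwo_mult)

lemma supp_power: "supp y \<subseteq> S \<Longrightarrow> supp (y ^ n) \<subseteq> power_set S n"
proof (induction n)
  case 0
  then show ?case by (auto simp: in_supp_iff coeff_1 split: if_splits)
next
  case (Suc n)
  then have "supp_mult y (y ^ n) \<subseteq> power_set S (Suc n)" by (auto simp: supp_mult_def)
  then show ?case using supp_mult_subset[of y "y ^ n"] by simp
qed

text \<open>A coefficient of \<open>x\<^sup>p\<close> only involves finitely many terms of \<open>x\<close>, so that the additivity of
  Frobenius on finite sums suffices.\<close>

lemma supp_power_prime: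
  assumes p: "prime p" and q: "\<not> int p dvd coeff (x ^ p) q"
  shows "\<exists>s>0. q = s ^ p"
proof -
  \<comment> \<open>The exponents of \<open>x\<close> that can be one of \<open>p\<close> factors of
    a product equal to \<open>q\<close>. Once they are removed, the \<open>p\<close>-th power of the
    remainder \<open>y\<close> has no term at \<open>q\<close>.\<close>
  define F where "F = {a \<in> supp x. q / a \<in> power_set (supp x) (p - 1)}"
  have F: "finite F" unfolding F_def
    by (intro rwo_finite_factorizations rwo_supp rwo_power_set)
  define y where "y = x - trunc F x"
  have "q \<notin> supp (y ^ p)"
  proof
    assume "q \<in> supp (y ^ p)"
    then have "q \<in> supp_mult y (y ^ (p - 1))"
      using supp_mult_subset[of y "y ^ (p - 1)"] prime_gt_0_nat[OF p] by (metis power_eq_if subsetD less_not_refl)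
    then obtain a b where ab: "q = a * b" "a \<in> supp y" "b \<in> supp (y ^ (p - 1))"
      by (auto simp: supp_mult_def)
    have "supp y \<subseteq> supp x" by (auto simp: y_def in_supp_iff coeff_trunc split: if_splits)
    then have "b \<in> power_set (supp x) (p - 1)" using ab supp_power by blast
    moreover have "q / a = b" using ab supp_pos[of a y] by simp
    ultimately have "a \<in> F" using ab \<open>supp y \<subseteq> supp x\<close> by (auto simp: F_def)
    then show False using ab(2) by (simp add: y_def in_supp_iff coeff_trunc)
  qed
  moreover have "trunc F x = (\<Sum>a\<in>F. monom (coeff x a) a)"
  proof (rule hahn_eqI)
    fix r
    have "coeff (\<Sum>a\<in>F. monom (coeff x a) a) r = (\<Sum>a\<in>F. if r = a then coeff x a else 0)"
      unfolding coeff_sum by (intro sum.cong) (auto simp: F_def coeff_monom supp_pos)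
    then show "coeff (trunc F x) r = coeff (\<Sum>a\<in>F. monom (coeff x a) a) r"
      using F by (simp add: coeff_trunc)
  qed
  moreover obtain z where "(trunc F x + y) ^ p = trunc F x ^ p + y ^ p + of_nat p * z"
    using freshmans_dream_mod[OF p] by blast
  moreover obtain z' where
    "(\<Sum>a\<in>F. monom (coeff x a) a) ^ p = (\<Sum>a\<in>F. monom (coeff x a) a ^ p) + of_nat p * z'"
    using freshmans_dream_sum_mod[OF p F] by blast
  moreover have "trunc F x + y = x" by (simp add: y_def)
  ultimately have "coeff (x ^ p) q = (\<Sum>a\<in>F. coeff (monom (coeff x a) a ^ p) q) + int p * (coeff z q + coeff z' q)"
    by (simp add: coeff_sum coeff_of_nat_mult in_supp_iff distrib_left)
  then have "(\<Sum>a\<in>F. coeff (monom (coeff x a) a ^ p) q) \<noteq> 0" using q by auto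
  then obtain a where a: "a \<in> F" "coeff (monom (coeff x a) a ^ p) q \<noteq> 0" by (meson sum.neutral)
  then have "0 < a" by (auto simp: F_def supp_pos)
  then show ?thesis using a(2) by (auto simp: monom_power coeff_monom split: if_splits)
qed

section \<open>The absolute value, and coefficients modulo p\<close>

definition lead :: "hahn \<Rightarrow> rat" where
  "lead x = (GREATEST q. q \<in> supp x)"

definition nrm :: "hahn \<Rightarrow> real" where
  "nrm x = (if x = 0 then 0 else of_rat (lead x))"

lemma lead_eqI: "q \<in> supp x \<Longrightarrow> (\<And>r. r \<in> supp x \<Longrightarrow> r \<le> q) \<Longrightarrow> lead x = q"
  unfolding lead_def by (rule Greatest_equality)

lemma supp_eq_empty_iff: "supp x = {} \<longleftrightarrow> x = 0"
  by (auto simp: supp_def intro: hahn_eqI)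

lemma lead:
  assumes "x \<noteq> 0" shows "lead x \<in> supp x" "\<And>r. r \<in> supp x \<Longrightarrow> r \<le> lead x" "0 < lead x"
proof -
  obtain m where m: "m \<in> supp x" "\<forall>r\<in>supp x. r \<le> m"
    using rwoD[OF rwo_supp, of "supp x" x] assms by (auto simp: supp_eq_empty_iff)
  then have "lead x = m" by (intro lead_eqI) auto
  then show "lead x \<in> supp x" "\<And>r. r \<in> supp x \<Longrightarrow> r \<le> lead x" "0 < lead x"
    using m supp_pos by auto
qed

lemma nrm_eqI: "q \<in> supp x \<Longrightarrow> (\<And>r. r \<in> supp x \<Longrightarrow> r \<le> q) \<Longrightarrow> nrm x = of_rat q"
  using lead_eqI[of q x] by (auto simp: nrm_def supp_def)

lemma nrm_nonneg: "0 \<le> nrm x"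
  using lead(3)[of x] by (auto simp: nrm_def)

lemma nrm_eq_0_iff: "nrm x = 0 \<longleftrightarrow> x = 0"
  using lead(3)[of x] by (auto simp: nrm_def)

lemma nrm_le_iff: "0 \<le> r \<Longrightarrow> nrm x \<le> r \<longleftrightarrow> (\<forall>q\<in>supp x. of_rat q \<le> r)"
  using lead[of x] by (cases "x = 0") (auto simp: nrm_def supp_def intro: order_trans[rotated] simp: of_rat_less_eq)

lemma nrm_less_iff: "0 < r \<Longrightarrow> nrm x < r \<longleftrightarrow> (\<forall>q\<in>supp x. of_rat q < r)"
  using lead[of x] by (cases "x = 0") (auto simp: nrm_def supp_def intro: le_less_trans[rotated] simp: of_rat_less_eq)

text \<open>For positive \<open>p\<close> the residues are the integers from 0 to
  \<open>p - 1\<close>, so the fixed points of \<open>red p\<close> represent the series over the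
  field with \<open>p\<close> elements, each exactly once.\<close>

definition red :: "nat \<Rightarrow> hahn \<Rightarrow> hahn" where
  "red p x = Abs_hahn (\<lambda>q. coeff x q mod int p)"

lemma coeff_red: "coeff (red p x) q = coeff x q mod int p"
  unfolding red_def by (subst coeff_Abs_hahn[OF rwo_supp[of x]]) (auto simp: in_supp_iff)

lemma red_eq_iff: "red p x = red p y \<longleftrightarrow> (\<forall>q. coeff x q mod int p = coeff y q mod int p)"
  by (metis coeff_red hahn_eqI)

lemma red_red [simp]: "red p (red p x) = red p x"
  by (simp add: red_eq_iff coeff_red)

lemma supp_red: "supp (red p x) \<subseteq> supp x"
  by (auto simp: in_supp_iff coeff_red)

lemma red_add_left: "red p (red p x + y) = red p (x + y)"
  and red_add_right: "red p (x + red p y) = red p (x + y)"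
  and red_diff_left: "red p (red p x - y) = red p (x - y)"
  and red_diff_right: "red p (x - red p y) = red p (x - y)"
  by (simp_all add: red_eq_iff coeff_red mod_simps)

lemma red_mult_left: "red p (red p x * y) = red p (x * y)"
proof -
  define z where "z = Abs_hahn (\<lambda>q. coeff x q div int p)"
  have z: "coeff z q = coeff x q div int p" for q
    unfolding z_def by (subst coeff_Abs_hahn[OF rwo_supp[of x]]) (auto simp: in_supp_iff)
  have "x = red p x + of_nat p * z"
    by (rule hahn_eqI) (simp add: coeff_red coeff_of_nat_mult z)
  then have "x * y = red p x * y + of_nat p * (z * y)" by (metis distrib_right mult.assoc)
  then show ?thesis by (simp add: red_eq_iff coeff_of_nat_mult)
qed

lemma red_mult_right: "red p (x * red p y) = red p (x * y)"
  using red_mult_left[of p y x] by (simp add: mult.commute)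

lemmas red_simps = red_add_left red_add_right red_diff_left red_diff_right red_mult_left red_mult_right

section \<open>Continuous functionals on a field that is not spherically complete\<close>

text \<open>Kept apart from the field case because \<open>field_if_approx_inverses\<close> is
  applied to \<open>k\<close> at a point where \<open>k\<close> is only known to be a ring.\<close>

locale nonarch_ring = cring R for R (structure) +
  fixes v :: "'a \<Rightarrow> real"
  assumes nonarch: "nonarch_abs R v" and nontrivial: "\<one> \<noteq> \<zero>"
begin

lemma v_nonneg: "x \<in> carrier R \<Longrightarrow> 0 \<le> v x"
  and v_eq_0_iff: "x \<in> carrier R \<Longrightarrow> v x = 0 \<longleftrightarrow> x = \<zero>"
  and v_add: "x \<in> carrier R \<Longrightarrow> y \<in> carrier R \<Longrightarrow> v (x \<oplus> y) \<le> max (v x) (v y)"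
  and v_mult: "x \<in> carrier R \<Longrightarrow> y \<in> carrier R \<Longrightarrow> v (x \<otimes> y) = v x * v y"
  using nonarch by (auto simp: nonarch_abs_def)

lemma v_zero: "v \<zero> = 0"
  by (simp add: v_eq_0_iff)

lemma v_pos_iff: "x \<in> carrier R \<Longrightarrow> 0 < v x \<longleftrightarrow> x \<noteq> \<zero>"
  using v_nonneg[of x] v_eq_0_iff[of x] by auto

lemma v_one: "v \<one> = 1"
proof -
  have "v \<one> * v \<one> = v \<one>" using v_mult[of \<one> \<one>] by simp
  moreover have "v \<one> \<noteq> 0" by (simp add: v_eq_0_iff nontrivial)
  ultimately show ?thesis by simp
qed

lemma v_uminus: "x \<in> carrier R \<Longrightarrow> v (\<ominus> x) = v x"
proof -
  assume x: "x \<in> carrier R"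
  have "v (\<ominus> \<one>) * v (\<ominus> \<one>) = 1" using v_mult[of "\<ominus> \<one>" "\<ominus> \<one>"] by (simp add: l_minus v_one)
  then have "v (\<ominus> \<one>) = 1" using v_nonneg[of "\<ominus> \<one>"]
    by (metis a_inv_closed abs_of_nonneg one_closed power2_eq_1_iff power2_eq_square abs_1 abs_minus_cancel)
  moreover have "\<ominus> x = \<ominus> \<one> \<otimes> x" using x by (simp add: l_minus)
  ultimately show ?thesis using v_mult[of "\<ominus> \<one>" x] x by simp
qed

lemma v_diff: "x \<in> carrier R \<Longrightarrow> y \<in> carrier R \<Longrightarrow> v (x \<ominus> y) \<le> max (v x) (v y)"
  using v_add[of x "\<ominus> y"] by (simp add: a_minus_def v_uminus)

lemma v_diff_commute: "x \<in> carrier R \<Longrightarrow> y \<in> carrier R \<Longrightarrow> v (x \<ominus> y) = v (y \<ominus> x)"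
  using v_uminus[of "x \<ominus> y"] by (simp add: a_minus_def minus_add a_comm)

lemma v_pow: "x \<in> carrier R \<Longrightarrow> v (x [^] (n::nat)) = v x ^ n"
  by (induction n) (auto simp: v_one v_mult)

text \<open>Geometric series: with z = 1 - x y of absolute value less than 1, the partial sums of
  the powers of z converge to some l with l = 1 + z l. Hence x y l = 1.\<close>

lemma field_if_approx_inverses:
  assumes complete: "abs_complete R v"
    and approx: "\<And>x. x \<in> carrier R \<Longrightarrow> x \<noteq> \<zero> \<Longrightarrow> \<exists>y\<in>carrier R. v (x \<otimes> y \<ominus> \<one>) < 1"
  shows "field R"
proof (rule cring_fieldI2)
  show "\<zero> \<noteq> \<one>" using nontrivial by simp
  fix x assume x: "x \<in> carrier R" "x \<noteq> \<zero>"
  then obtain y where y: "y \<in> carrier R" "v (x \<otimes> y \<ominus> \<one>) < 1" using approx by blast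
  define z where "z = \<one> \<ominus> x \<otimes> y"
  have z: "z \<in> carrier R" using x y by (simp add: z_def)
  have vz: "0 \<le> v z" "v z < 1" using x y z v_nonneg v_diff_commute[of "x \<otimes> y" \<one>] by (auto simp: z_def)
  \<comment> \<open>Partial sums in Horner form: two of them differ by z times the difference of
    their predecessors, which turns the Cauchy estimate into an induction.\<close>
  define s where "s = rec_nat \<zero> (\<lambda>_ t. \<one> \<oplus> z \<otimes> t)"
  have s0: "s 0 = \<zero>" and sS: "s (Suc k) = \<one> \<oplus> z \<otimes> s k" for k by (simp_all add: s_def)
  have sc: "s k \<in> carrier R" for k by (induction k) (auto simp: s0 sS z)
  have "v (s k) \<le> 1" for k
  proof (induction k)
    case (Suc k)
    have "v z * v (s k) \<le> 1 * 1" using vz Suc sc v_nonneg by (intro mult_mono) auto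
    then show ?case using v_add[of \<one> "z \<otimes> s k"] z sc by (simp add: sS v_one v_mult)
  qed (simp add: s0 v_zero)
  then have cauchy: "v (s (k + i) \<ominus> s k) \<le> v z ^ k" for k i
  proof (induction k)
    case 0
    then show ?case using sc by (simp add: s0 a_minus_def)
  next
    case (Suc k)
    have alg: "\<one> \<oplus> c \<otimes> a \<ominus> (\<one> \<oplus> c \<otimes> b) = c \<otimes> (a \<ominus> b)"
      if "a \<in> carrier R" "b \<in> carrier R" "c \<in> carrier R" for a b c using that by algebra
    show ?case using Suc vz z sc by (simp add: sS alg v_mult mult_left_mono)
  qed
  have "\<exists>N. \<forall>i\<ge>N. \<forall>j\<ge>N. v (s i \<ominus> s j) < e" if e: "0 < e" for e
  proof -
    obtain N where N: "v z ^ N < e" using real_arch_pow_inv[OF e vz(2)] by blast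
    have "v (s i \<ominus> s j) < e" if ij: "N \<le> i" "N \<le> j" for i j
    proof -
      have "s i \<ominus> s j = (s i \<ominus> s N) \<ominus> (s j \<ominus> s N)"
      proof -
        have "a \<ominus> b = (a \<ominus> c) \<ominus> (b \<ominus> c)"
          if "a \<in> carrier R" "b \<in> carrier R" "c \<in> carrier R" for a b c using that by algebra
        then show ?thesis using sc by simp
      qed
      then have "v (s i \<ominus> s j) \<le> max (v (s i \<ominus> s N)) (v (s j \<ominus> s N))"
        using v_diff[of "s i \<ominus> s N" "s j \<ominus> s N"] sc by simp
      then show ?thesis
        using cauchy[of N "i - N"] cauchy[of N "j - N"] ij N by auto
    qed
    then show ?thesis by blast
  qed
  then have "\<exists>l\<in>carrier R. \<forall>e>0. \<exists>N. \<forall>i\<ge>N. v (s i \<ominus> l) < e"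
    by (intro complete[unfolded abs_complete_def, rule_format]) (simp add: sc)
  then obtain l where l: "l \<in> carrier R" "\<And>e. 0 < e \<Longrightarrow> \<exists>N. \<forall>i\<ge>N. v (s i \<ominus> l) < e" by blast
  have "v (l \<ominus> (\<one> \<oplus> z \<otimes> l)) < e" if e: "0 < e" for e
  proof -
    obtain N where N: "\<And>i. N \<le> i \<Longrightarrow> v (s i \<ominus> l) < e" using l(2)[OF e] by blast
    have alg: "a \<ominus> (\<one> \<oplus> c \<otimes> a) = c \<otimes> (b \<ominus> a) \<ominus> ((\<one> \<oplus> c \<otimes> b) \<ominus> a)"
      if "a \<in> carrier R" "b \<in> carrier R" "c \<in> carrier R" for a b c using that by algebra
    have "v (l \<ominus> (\<one> \<oplus> z \<otimes> l)) \<le> max (v (z \<otimes> (s N \<ominus> l))) (v (s (Suc N) \<ominus> l))"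
      unfolding alg[OF l(1) sc[of N] z] sS using l sc z by (intro v_diff) auto
    moreover have "v z * v (s N \<ominus> l) \<le> 1 * v (s N \<ominus> l)"
      using vz l sc v_nonneg by (intro mult_right_mono) auto
    ultimately show ?thesis using N[of N] N[of "Suc N"] l z sc by (simp add: v_mult)
  qed
  from this[of "v (l \<ominus> (\<one> \<oplus> z \<otimes> l))"] have "v (l \<ominus> (\<one> \<oplus> z \<otimes> l)) = 0"
    using v_nonneg[of "l \<ominus> (\<one> \<oplus> z \<otimes> l)"] l(1) z by force
  then have "l \<ominus> (\<one> \<oplus> z \<otimes> l) = \<zero>" using l(1) z v_eq_0_iff by simp
  moreover have "x \<otimes> (y \<otimes> l) = l \<ominus> (\<one> \<oplus> z \<otimes> l) \<oplus> \<one>"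
    unfolding z_def using x y l by algebra
  ultimately have "x \<otimes> (y \<otimes> l) = \<one>" by simp
  then show "\<exists>b\<in>carrier R. x \<otimes> b = \<one>" using y l by blast
qed

end

section \<open>Bounded functionals and spherically complete subspaces\<close>

locale nonarch_field = nonarch_ring + field
begin

lemma v_inv: "x \<in> carrier R \<Longrightarrow> x \<noteq> \<zero> \<Longrightarrow> v (inv x) = inverse (v x)"
proof -
  assume x: "x \<in> carrier R" "x \<noteq> \<zero>"
  then have u: "x \<in> Units R" by (simp add: field_Units)
  then have "v x * v (inv x) = 1" using v_mult[of x "inv x"] x v_one by simp
  then show ?thesis by (simp add: inverse_unique)
qed

text \<open>Rescaling: density of the values yields r with |r|^p |a| between \<delta> / 2 and
  \<delta>. Then |r| |\<phi>(a)| \<le> D, and eliminating |r| bounds |\<phi>(a)|^p by a multiple of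
  |a|. The factor 2 pays for hitting an interval instead of the exact value.\<close>

lemma p_inv_linear_homogeneous_bound:
  assumes p: "0 < p" and \<phi>: "p_inv_linear R p \<phi>" and \<delta>: "0 < \<delta>"
    and cont: "\<And>a. a \<in> carrier R \<Longrightarrow> v a \<le> \<delta> \<Longrightarrow> v (\<phi> a) \<le> B"
    and dense: "\<And>x y::real. 0 < x \<Longrightarrow> x < y \<Longrightarrow> \<exists>r\<in>carrier R. x < v r \<and> v r < y"
  obtains C where "0 < C" "\<And>a. a \<in> carrier R \<Longrightarrow> v (\<phi> a) ^ p \<le> C * v a"
proof
  have \<phi>c: "\<phi> a \<in> carrier R" if "a \<in> carrier R" for a using \<phi> that by (simp add: p_inv_linear_def)
  have \<phi>r: "\<phi> (r [^] p \<otimes> a) = r \<otimes> \<phi> a" if "a \<in> carrier R" "r \<in> carrier R" for a r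
    using \<phi> that by (simp add: p_inv_linear_def)
  have \<phi>0: "\<phi> \<zero> = \<zero>"
    using \<phi>r[of \<zero> \<zero>] \<phi>c[of \<zero>] by (simp add: p nat_pow_zero)
  define D where "D = max B 1"
  have D: "0 < D" "\<And>a. a \<in> carrier R \<Longrightarrow> v a \<le> \<delta> \<Longrightarrow> v (\<phi> a) \<le> D"
    using cont by (auto simp: D_def le_max_iff_disj)
  show "0 < 2 * D ^ p / \<delta>" using D \<delta> by simp
  fix a assume a: "a \<in> carrier R"
  show "v (\<phi> a) ^ p \<le> 2 * D ^ p / \<delta> * v a"
  proof (cases "a = \<zero>")
    case True
    then show ?thesis using p by (simp add: \<phi>0 v_zero power_0_left)
  next
    case False
    then have va: "0 < v a" using a by (simp add: v_pos_iff)
    have "root p (\<delta> / (2 * v a)) < root p (\<delta> / v a)"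
      using p \<delta> va by (intro real_root_less_mono) (auto simp: field_simps)
    moreover have "0 < root p (\<delta> / (2 * v a))" using p \<delta> va by simp
    ultimately obtain r where
      r: "r \<in> carrier R" "root p (\<delta> / (2 * v a)) < v r" "v r < root p (\<delta> / v a)"
      using dense by blast
    have "v r ^ p \<le> root p (\<delta> / v a) ^ p" using r v_nonneg by (intro power_mono) auto
    then have le: "v r ^ p * v a \<le> \<delta>" using p \<delta> va by (simp add: field_simps)
    have "root p (\<delta> / (2 * v a)) ^ p \<le> v r ^ p"
      using r p \<delta> va by (intro power_mono) auto
    then have ge: "\<delta> \<le> 2 * v r ^ p * v a" using p \<delta> va by (simp add: field_simps)
    have "v (\<phi> (r [^] p \<otimes> a)) \<le> D" using a r le by (intro D) (auto simp: v_mult v_pow)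
    then have "v r * v (\<phi> a) \<le> D" using a r \<phi>c by (simp add: \<phi>r v_mult)
    then have "(v r * v (\<phi> a)) ^ p \<le> D ^ p"
      using a r \<phi>c v_nonneg by (intro power_mono) auto
    then have "v r ^ p * v (\<phi> a) ^ p * (2 * v a) \<le> D ^ p * (2 * v a)"
      using va by (simp add: power_mult_distrib)
    moreover have "\<delta> * v (\<phi> a) ^ p \<le> 2 * v r ^ p * v a * v (\<phi> a) ^ p"
      using ge v_nonneg[OF \<phi>c[OF a]] by (intro mult_right_mono) auto
    ultimately have "\<delta> * v (\<phi> a) ^ p \<le> D ^ p * (2 * v a)" by (simp add: mult_ac)
    then show ?thesis using \<delta> by (simp add: field_simps)
  qed
qed

text \<open>A nonzero bounded functional restricted to a spherically complete subspace \<open>L\<close> would make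
  its image, hence the field itself, spherically complete: one lifts the terms of the
  pseudo-Cauchy series \<open>\<Sum> g n\<close> to \<open>L\<close> with norms so close to the optimal ones that the lifted
  series is still pseudo-Cauchy.\<close>

theorem p_inv_linear_zero_if_spherically_complete_subspace:
  assumes p: "0 < p" and \<phi>: "p_inv_linear R p \<phi>" and \<delta>: "0 < \<delta>"
    and cont: "\<And>a. a \<in> carrier R \<Longrightarrow> v a \<le> \<delta> \<Longrightarrow> v (\<phi> a) \<le> B"
    and dense: "\<And>x y::real. 0 < x \<Longrightarrow> x < y \<Longrightarrow> \<exists>r\<in>carrier R. x < v r \<and> v r < y"
    and L: "L \<subseteq> carrier R" "\<one> \<in> L" "\<And>x y. x \<in> L \<Longrightarrow> y \<in> L \<Longrightarrow> x \<oplus> y \<in> L"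
      "\<And>x. x \<in> L \<Longrightarrow> \<ominus> x \<in> L" "\<And>x y. x \<in> carrier R \<Longrightarrow> y \<in> L \<Longrightarrow> x [^] p \<otimes> y \<in> L"
    and spherical: "\<And>X r. (\<And>n::nat. X n \<in> L) \<Longrightarrow> (\<And>n. 0 < r n) \<Longrightarrow>
        (\<And>m n. n \<le> m \<Longrightarrow> v (X m \<ominus> X n) \<le> r n) \<Longrightarrow> \<exists>l\<in>L. \<forall>n. v (l \<ominus> X n) \<le> r n"
    and g: "\<And>n::nat. g n \<in> carrier R" "\<And>n. 0 < v (g n)" "\<And>n. v (g (Suc n)) < v (g n)"
    and S: "S 0 = g 0" "\<And>n. S (Suc n) = S n \<oplus> g (Suc n)"
    and no_limit: "\<And>w. w \<in> carrier R \<Longrightarrow> \<exists>n. \<not> v (w \<ominus> S n) < v (g n)"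
    and x0: "x0 \<in> carrier R"
  shows "\<phi> x0 = \<zero>"
proof (rule ccontr)
  assume nz: "\<phi> x0 \<noteq> \<zero>"
  obtain C where C: "0 < C" "\<And>a. a \<in> carrier R \<Longrightarrow> v (\<phi> a) ^ p \<le> C * v a"
    using p_inv_linear_homogeneous_bound[OF p \<phi> \<delta> cont dense] by blast
  \<comment> \<open>Composing with multiplication by \<open>x0\<close> replaces the subspace
    \<open>x0 L\<close> by \<open>L\<close>, and makes \<psi>(1) nonzero.\<close>
  define \<psi> where "\<psi> u = \<phi> (x0 \<otimes> u)" for u
  have Lc: "u \<in> carrier R" if "u \<in> L" for u using that L(1) by blast
  have Ld: "x \<ominus> y \<in> L" if "x \<in> L" "y \<in> L" for x y using that L by (simp add: a_minus_def)
  have \<psi>c: "\<psi> u \<in> carrier R" if "u \<in> carrier R" for u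
    using \<phi> x0 that by (simp add: p_inv_linear_def \<psi>_def)
  have \<psi>a: "\<psi> (x \<oplus> y) = \<psi> x \<oplus> \<psi> y" if "x \<in> carrier R" "y \<in> carrier R" for x y
    using \<phi> x0 that by (simp add: p_inv_linear_def \<psi>_def r_distr)
  have \<psi>d: "\<psi> (x \<ominus> y) = \<psi> x \<ominus> \<psi> y" if "x \<in> carrier R" "y \<in> carrier R" for x y
  proof -
    have "x \<ominus> y \<oplus> y = x" using that by algebra
    then have "\<psi> x = \<psi> (x \<ominus> y) \<oplus> \<psi> y" using \<psi>a[of "x \<ominus> y" y] that by simp
    moreover have "c \<oplus> b \<ominus> b = c" if "c \<in> carrier R" "b \<in> carrier R" for b c using that by algebra
    ultimately show ?thesis using that \<psi>c by simp
  qed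
  have \<psi>r: "\<psi> (r [^] p \<otimes> u) = r \<otimes> \<psi> u" if "r \<in> carrier R" "u \<in> carrier R" for r u
  proof -
    have "x0 \<otimes> (r [^] p \<otimes> u) = r [^] p \<otimes> (x0 \<otimes> u)" using that x0 by (simp add: m_lcomm)
    then show ?thesis using \<phi> x0 that by (simp add: p_inv_linear_def \<psi>_def)
  qed
  have \<psi>1: "\<psi> \<one> \<noteq> \<zero>" using nz x0 by (simp add: \<psi>_def)
  have bound: "v (\<psi> u) ^ p \<le> C * v x0 * v u" if "u \<in> carrier R" for u
    using C(2)[of "x0 \<otimes> u"] x0 that by (simp add: \<psi>_def v_mult mult_ac)

  \<comment> \<open>\<open>M\<close> is the analogue of the operator norm of \<psi> on
    \<open>L\<close>. The \<open>p\<close>-th power in the numerator makes the quotients invariant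
    under scaling by \<open>p\<close>-th powers; the element 1 of \<open>L\<close> shows that
    \<open>M\<close> is positive.\<close>
  define Q where "Q = {v (\<psi> u) ^ p / v u |u. u \<in> L \<and> u \<noteq> \<zero>}"
  define M where "M = Sup Q"
  have bdd: "bdd_above Q"
  proof (rule bdd_aboveI)
    fix t assume "t \<in> Q"
    then obtain u where "t = v (\<psi> u) ^ p / v u" "u \<in> L" "u \<noteq> \<zero>" by (auto simp: Q_def)
    then show "t \<le> C * v x0" using bound[of u] Lc[of u] by (simp add: v_pos_iff divide_le_eq)
  qed
  have Q1: "v (\<psi> \<one>) ^ p \<in> Q" unfolding Q_def using L(2) by (force simp: v_one)
  have M: "0 < M"
  proof -
    have "0 < v (\<psi> \<one>) ^ p" using \<psi>1 \<psi>c by (simp add: v_pos_iff)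
    also have "\<dots> \<le> M" unfolding M_def by (rule cSup_upper[OF Q1 bdd])
    finally show ?thesis .
  qed
  have M_bound: "v (\<psi> u) ^ p \<le> M * v u" if "u \<in> L" for u
  proof (cases "u = \<zero>")
    case True
    then show ?thesis using bound[of u] by (simp add: v_zero)
  next
    case False
    then have "v (\<psi> u) ^ p / v u \<le> M"
      unfolding M_def using that by (intro cSup_upper bdd) (auto simp: Q_def)
    then show ?thesis using False Lc[OF that] by (simp add: v_pos_iff divide_le_eq)
  qed
  \<comment> \<open>Take an element of \<open>L\<close> whose quotient exceeds M |c|^p / \<rho> and
    multiply it by the \<open>p\<close>-th power of r = c / \<psi>(u). Its image becomes c and its
    quotient is unchanged, which says exactly that M times its norm is below \<rho>.\<close>
  have lift: "\<exists>u\<in>L. \<psi> u = c \<and> M * v u < \<rho>" if c: "c \<in> carrier R" "0 < v c" "v c ^ p < \<rho>" for c \<rho>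
  proof -
    have \<rho>: "0 < \<rho>" using c by (meson less_trans zero_less_power)
    have "M * v c ^ p / \<rho> < M" using M \<rho> c by (simp add: divide_less_eq)
    then obtain t where "t \<in> Q" "M * v c ^ p / \<rho> < t"
      using less_cSup_iff[of Q] bdd Q1 unfolding M_def by blast
    then obtain u where u: "u \<in> L" "u \<noteq> \<zero>" "M * v c ^ p / \<rho> < v (\<psi> u) ^ p / v u"
      unfolding Q_def by blast
    have vu: "0 < v u" using u Lc by (simp add: v_pos_iff)
    have "0 \<le> M * v c ^ p / \<rho>" using M \<rho> c by simp
    then have "v (\<psi> u) \<noteq> 0" using u(3) p by (auto simp: power_0_left)
    then have nzu: "\<psi> u \<noteq> \<zero>" and vpu: "0 < v (\<psi> u)" using v_zero v_nonneg[OF \<psi>c[OF Lc[OF u(1)]]] by auto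
    define r where "r = c \<otimes> inv (\<psi> u)"
    have un: "\<psi> u \<in> Units R" using nzu \<psi>c[OF Lc[OF u(1)]] by (simp add: field_Units)
    have r: "r \<in> carrier R" using c un by (simp add: r_def)
    have "\<psi> (r [^] p \<otimes> u) = c"
      using r u Lc un c by (simp add: \<psi>r) (simp add: r_def m_assoc \<psi>c)
    moreover have "M * v (r [^] p \<otimes> u) < \<rho>"
    proof -
      have "v r = v c / v (\<psi> u)"
        using c un nzu \<psi>c[OF Lc[OF u(1)]] by (simp add: r_def v_mult v_inv divide_inverse)
      then have "M * v (r [^] p \<otimes> u) = M * (v c / v (\<psi> u)) ^ p * v u"
        using r u Lc by (simp add: v_mult v_pow)
      also have "\<dots> < \<rho>" using u(3) vu vpu \<rho> by (simp add: power_divide field_simps)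
      finally show ?thesis .
    qed
    ultimately show ?thesis using L(5)[OF r u(1)] by blast
  qed
  \<comment> \<open>A lift of \<open>g n\<close> with M |u| \<le> |g n|^p need not exist. Since |g
    n| < |g (n - 1)|, asking only for the preceding value leaves room for a lift; the term with
    index 0 needs no bound.\<close>
  have "\<forall>n. \<exists>u\<in>L. \<psi> u = g n \<and> (0 < n \<longrightarrow> M * v u < v (g (n - 1)) ^ p)"
  proof
    fix n
    show "\<exists>u\<in>L. \<psi> u = g n \<and> (0 < n \<longrightarrow> M * v u < v (g (n - 1)) ^ p)"
    proof (cases n)
      case 0
      then show ?thesis using lift[of "g 0" "v (g 0) ^ p + 1"] g by auto
    next
      case (Suc m)
      have "v (g n) ^ p < v (g m) ^ p"
        using g(2)[of n] g(3)[of m] Suc p by (intro power_strict_mono) auto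
      then show ?thesis using lift[of "g n"] g Suc by auto
    qed
  qed
  then obtain u where u: "\<And>n. u n \<in> L" "\<And>n. \<psi> (u n) = g n"
    and vu: "\<And>n. 0 < n \<Longrightarrow> M * v (u n) < v (g (n - 1)) ^ p" by metis
  define X where "X = rec_nat (u 0) (\<lambda>n x. x \<oplus> u (Suc n))"
  have X: "X 0 = u 0" "\<And>n. X (Suc n) = X n \<oplus> u (Suc n)" by (simp_all add: X_def)
  have XL: "X n \<in> L" for n by (induction n) (auto simp: X u L)
  have \<psi>X: "\<psi> (X n) = S n" for n
    by (induction n) (auto simp: X S u \<psi>a Lc XL)
  define r where "r n = v (g n) ^ p / M" for n
  have r_pos: "0 < r n" for n using M g by (simp add: r_def)
  have r_dec: "r (Suc n) < r n" for n
    using M g(2)[of "Suc n"] g(3)[of n] p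
    by (auto simp: r_def intro!: divide_strict_right_mono power_strict_mono)
  have r_anti: "r m \<le> r n" if "n \<le> m" for m n
    using that r_dec by (intro decseqD[of r]) (auto simp: decseq_Suc_iff less_imp_le)
  have vu': "v (u (Suc n)) < r n" for n
    using vu[of "Suc n"] M by (simp add: r_def pos_less_divide_eq mult.commute)
  have vX: "v (X m \<ominus> X n) \<le> r n" if "n \<le> m" for m n
    using that
  proof (induction m rule: dec_induct)
    case base
    then show ?case using r_pos[of n] Lc[OF XL[of n]] by (simp add: r_neg a_minus_def v_zero)
  next
    case (step m)
    have "X (Suc m) \<ominus> X n = (X m \<ominus> X n) \<oplus> u (Suc m)"
      using Lc XL u by (simp add: X a_minus_def a_ac)
    then have "v (X (Suc m) \<ominus> X n) \<le> max (v (X m \<ominus> X n)) (v (u (Suc m)))"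
      using v_add[of "X m \<ominus> X n" "u (Suc m)"] Lc XL u by simp
    then show ?case using step vu'[of m] r_anti[of n m] by simp
  qed
  have "\<exists>l\<in>L. \<forall>n. v (l \<ominus> X n) \<le> r n" by (rule spherical) (use XL r_pos vX in auto)
  then obtain l where l: "l \<in> L" "\<And>n. v (l \<ominus> X n) \<le> r n" by blast
  have "v (\<psi> l \<ominus> S n) < v (g n)" for n
  proof -
    \<comment> \<open>The pseudo-limit l is only known to satisfy the weak inequality at each
      radius. Going through the next partial sum makes it strict, because both
      \<open>r (Suc n)\<close> and the norm of \<open>u (Suc n)\<close> lie strictly below
      \<open>r n\<close>.\<close>
    have "l \<ominus> X n = (l \<ominus> X (Suc n)) \<oplus> u (Suc n)"
    proof -
      have "a \<ominus> b = (a \<ominus> (b \<oplus> c)) \<oplus> c" if "a \<in> carrier R" "b \<in> carrier R" "c \<in> carrier R" for a b c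
        using that by algebra
      then show ?thesis using Lc XL u l by (simp add: X)
    qed
    then have "v (l \<ominus> X n) \<le> max (v (l \<ominus> X (Suc n))) (v (u (Suc n)))"
      using v_add[of "l \<ominus> X (Suc n)" "u (Suc n)"] Lc XL u l by simp
    also have "\<dots> < r n" using l(2)[of "Suc n"] r_dec[of n] vu'[of n] by simp
    finally have "M * v (l \<ominus> X n) < v (g n) ^ p"
      using M by (simp add: r_def pos_less_divide_eq mult.commute)
    moreover have "v (\<psi> l \<ominus> S n) ^ p \<le> M * v (l \<ominus> X n)"
      using M_bound[OF Ld[OF l(1) XL[of n]]] Lc XL l by (simp add: \<psi>d \<psi>X)
    ultimately have "v (\<psi> l \<ominus> S n) ^ p < v (g n) ^ p" by simp
    then show ?thesis using g(2)[of n] power_less_imp_less_base by (metis less_imp_le)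
  qed
  then show False using no_limit[OF \<psi>c[OF Lc[OF l(1)]]] by blast
qed

end

section \<open>Tate algebras\<close>

context nonarch_field
begin

definition tmonom :: "'a \<Rightarrow> nat list \<Rightarrow> nat list \<Rightarrow> 'a" where
  "tmonom c \<kappa> = (\<lambda>\<mu>. if \<mu> = \<kappa> then c else \<zero>)"

text \<open>The exponent vector of the \<open>m\<close>-th power of the variable with index
  \<open>j\<close>, counted from 0.\<close>

definition shift :: "nat \<Rightarrow> nat \<Rightarrow> nat \<Rightarrow> nat list" where
  "shift n j m = (replicate n 0)[j := m]"

definition restr :: "nat list set \<Rightarrow> (nat list \<Rightarrow> 'a) \<Rightarrow> nat list \<Rightarrow> 'a" where
  "restr D f = (\<lambda>\<mu>. if \<mu> \<in> D then f \<mu> else \<zero>)"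

lemma length_shift [simp]: "length (shift n j m) = n"
  by (simp add: shift_def)

lemma shift_0: "shift n j 0 = replicate n 0"
  by (cases "j < n") (auto intro!: nth_equalityI simp: shift_def nth_list_update list_update_beyond)

lemma carrier_tate_iff: "f \<in> carrier (tate R v n) \<longleftrightarrow>
    (\<forall>\<nu>. f \<nu> \<in> carrier R) \<and> (\<forall>\<nu>. length \<nu> \<noteq> n \<longrightarrow> f \<nu> = \<zero>) \<and>
    (\<forall>e>0. \<exists>N. \<forall>\<nu>. length \<nu> = n \<and> sum_list \<nu> \<ge> N \<longrightarrow> v (f \<nu>) < e)"
  by (simp add: tate_def tate_carrier_def)

lemma tate_coeff_closed: "f \<in> carrier (tate R v n) \<Longrightarrow> f \<nu> \<in> carrier R"
  by (simp add: carrier_tate_iff)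

lemma tate_add: "(f \<oplus>\<^bsub>tate R v n\<^esub> g) = (\<lambda>\<nu>. f \<nu> \<oplus> g \<nu>)"
  by (simp add: tate_def)

lemma tate_zero: "\<zero>\<^bsub>tate R v n\<^esub> = (\<lambda>\<nu>. \<zero>)"
  by (simp add: tate_def)

lemma restr_closed:
  assumes "f \<in> carrier (tate R v n)" shows "restr D f \<in> carrier (tate R v n)"
proof -
  have "\<exists>N. \<forall>\<nu>. length \<nu> = n \<and> sum_list \<nu> \<ge> N \<longrightarrow> v (restr D f \<nu>) < e" if "0 < e" for e
    using assms that unfolding carrier_tate_iff restr_def by (metis v_zero)
  then show ?thesis using assms by (auto simp: carrier_tate_iff restr_def)
qed

lemma restr_Un:
  assumes "f \<in> carrier (tate R v n)" "D \<inter> E = {}"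
  shows "restr (D \<union> E) f = restr D f \<oplus>\<^bsub>tate R v n\<^esub> restr E f"
  using assms by (auto simp: restr_def tate_add fun_eq_iff tate_coeff_closed)

lemma tmonom_closed:
  assumes "c \<in> carrier R" "length \<kappa> = n" shows "tmonom c \<kappa> \<in> carrier (tate R v n)"
proof -
  have "\<exists>N. \<forall>\<nu>. length \<nu> = n \<and> sum_list \<nu> \<ge> N \<longrightarrow> v (tmonom c \<kappa> \<nu>) < e" if "0 < e" for e
    using that by (intro exI[of _ "Suc (sum_list \<kappa>)"]) (auto simp: tmonom_def v_zero)
  then show ?thesis using assms by (auto simp: carrier_tate_iff tmonom_def)
qed

lemma finite_exponent_pairs:
  "finite {(\<mu>, \<mu>'). length \<mu> = n \<and> length \<mu>' = n \<and> map2 (+) \<mu> \<mu>' = (\<nu> :: nat list)}" (is "finite ?D")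
proof (rule finite_subset)
  let ?B = "{xs. set xs \<subseteq> {..sum_list \<nu>} \<and> length xs = n}"
  have "\<mu> \<in> ?B \<and> \<mu>' \<in> ?B"
    if *: "length \<mu> = n" "length \<mu>' = n" "map2 (+) \<mu> \<mu>' = \<nu>" for \<mu> \<mu>'
  proof -
    have "\<mu> ! i \<le> sum_list \<nu> \<and> \<mu>' ! i \<le> sum_list \<nu>" if "i < n" for i
    proof -
      have "\<nu> ! i \<le> sum_list \<nu>" using that * by (intro elem_le_sum_list) auto
      moreover have "\<nu> ! i = \<mu> ! i + \<mu>' ! i" using that * by auto
      ultimately show ?thesis by simp
    qed
    then show ?thesis using * by (auto simp: in_set_conv_nth)
  qed
  then show "?D \<subseteq> ?B \<times> ?B" by blast
  show "finite (?B \<times> ?B)" by (intro finite_cartesian_product finite_lists_length_eq) auto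
qed

lemma map2_add_shift:
  "j < n \<Longrightarrow> length \<mu> = n \<Longrightarrow> map2 (+) (shift n j m) \<mu> = \<mu>[j := \<mu> ! j + m]"
  by (rule nth_equalityI) (auto simp: shift_def nth_list_update)

lemma tmonom_shift_mult:
  assumes c: "c \<in> carrier R" and h: "h \<in> carrier (tate R v n)" and j: "j < n"
  shows "(tmonom c (shift n j m) \<otimes>\<^bsub>tate R v n\<^esub> h) \<nu> =
    (if length \<nu> = n \<and> m \<le> \<nu> ! j then c \<otimes> h (\<nu>[j := \<nu> ! j - m]) else \<zero>)"
proof -
  let ?D = "{(\<mu>, \<mu>'). length \<mu> = n \<and> length \<mu>' = n \<and> map2 (+) \<mu> \<mu>' = \<nu>}"
  let ?t = "\<lambda>(\<mu>, \<mu>'). tmonom c (shift n j m) \<mu> \<otimes> h \<mu>'"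
  let ?P = "length \<nu> = n \<and> m \<le> \<nu> ! j"
  let ?\<mu> = "\<nu>[j := \<nu> ! j - m]"
  have hc: "h \<mu> \<in> carrier R" for \<mu> using h by (rule tate_coeff_closed)
  have D: "?P \<and> \<mu>' = ?\<mu>" if "(shift n j m, \<mu>') \<in> ?D" for \<mu>'
    using that j by (auto simp: map2_add_shift)
  have eq: "(tmonom c (shift n j m) \<otimes>\<^bsub>tate R v n\<^esub> h) \<nu> = finsum R ?t ?D"
    by (simp add: tate_def)
  show ?thesis
  proof (cases ?P)
    case True
    then have in_D: "(shift n j m, ?\<mu>) \<in> ?D" using j by (auto simp: map2_add_shift)
    have "finsum R ?t ?D =
        finsum R (\<lambda>z. if (shift n j m, ?\<mu>) = z then ?t z else \<zero>) ?D"
    proof (rule finsum_cong')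
      fix z assume z: "z \<in> ?D"
      show "?t z = (if (shift n j m, ?\<mu>) = z then ?t z else \<zero>)"
        using z D hc by (cases z) (auto simp: tmonom_def)
    qed (use c hc in \<open>auto simp: tmonom_def\<close>)
    also have "\<dots> = ?t (shift n j m, ?\<mu>)"
      by (rule add.finprod_singleton[OF in_D finite_exponent_pairs]) (use c hc in \<open>auto simp: tmonom_def\<close>)
    finally show ?thesis using True unfolding eq by (simp add: tmonom_def)
  next
    case False
    have "finsum R ?t ?D = finsum R (\<lambda>z. \<zero>) ?D"
    proof (rule finsum_cong')
      fix z assume z: "z \<in> ?D"
      obtain \<mu> \<mu>' where z': "z = (\<mu>, \<mu>')" by (cases z)
      then have "\<mu> \<noteq> shift n j m" using z D False by blast
      then show "?t z = \<zero>" using z' hc by (simp add: tmonom_def)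
    qed auto
    also have "\<dots> = \<zero>" by (rule finsum_zero)
    finally show ?thesis using False unfolding eq by auto
  qed
qed

lemma tmonom_shift_mult_tmonom:
  assumes "c \<in> carrier R" "d \<in> carrier R" "length \<kappa> = n" "j < n"
  shows "tmonom c (shift n j m) \<otimes>\<^bsub>tate R v n\<^esub> tmonom d \<kappa> = tmonom (c \<otimes> d) (\<kappa>[j := \<kappa> ! j + m])"
proof
  fix \<nu>
  have "\<nu>[j := \<nu> ! j - m] = \<kappa> \<longleftrightarrow> \<nu> = \<kappa>[j := \<kappa> ! j + m]" if "length \<nu> = n" "m \<le> \<nu> ! j"
    using that assms by (auto simp: list_eq_iff_nth_eq nth_list_update)
  moreover have "length \<nu> = n \<and> m \<le> \<nu> ! j" if "\<nu> = \<kappa>[j := \<kappa> ! j + m]" using that assms by simp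
  ultimately have "(if length \<nu> = n \<and> m \<le> \<nu> ! j then c \<otimes> tmonom d \<kappa> (\<nu>[j := \<nu> ! j - m]) else \<zero>)
      = tmonom (c \<otimes> d) (\<kappa>[j := \<kappa> ! j + m]) \<nu>"
    unfolding tmonom_def using assms(1) by (metis r_null)
  then show "(tmonom c (shift n j m) \<otimes>\<^bsub>tate R v n\<^esub> tmonom d \<kappa>) \<nu> = tmonom (c \<otimes> d) (\<kappa>[j := \<kappa> ! j + m]) \<nu>"
    using assms by (simp only: tmonom_shift_mult tmonom_closed)
qed

lemma tmonom_shift_pow:
  assumes c: "c \<in> carrier R" and j: "j < n"
  shows "tmonom c (shift n j m) [^]\<^bsub>tate R v n\<^esub> (k::nat) = tmonom (c [^] k) (shift n j (k * m))"
proof (induction k)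
  case 0
  show ?case by (simp add: shift_0) (simp add: tate_def tmonom_def)
next
  case (Suc k)
  have "(shift n j m)[j := shift n j m ! j + k * m] = shift n j (m + k * m)"
    using j by (simp add: shift_def)
  then show ?case using Suc c j by (simp add: tmonom_shift_mult_tmonom)
qed

end

section \<open>Reduction from the Tate algebra to its field of constants\<close>

locale tate_p_inv_linear = nonarch_field +
  fixes p n :: nat and \<phi>
  assumes p: "0 < p" and n: "0 < n" and \<phi>: "p_inv_linear (tate R v n) p \<phi>"
begin

abbreviation "A \<equiv> tate R v n"

lemma \<phi>_closed: "x \<in> carrier A \<Longrightarrow> \<phi> x \<in> carrier A"
  and \<phi>_add: "x \<in> carrier A \<Longrightarrow> y \<in> carrier A \<Longrightarrow> \<phi> (x \<oplus>\<^bsub>A\<^esub> y) \<nu> = \<phi> x \<nu> \<oplus> \<phi> y \<nu>"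
  using \<phi> by (auto simp: p_inv_linear_def tate_add)

lemma \<phi>_coeff_closed: "x \<in> carrier A \<Longrightarrow> \<phi> x \<nu> \<in> carrier R"
  using \<phi>_closed tate_coeff_closed by blast

text \<open>Linearity applied to the scalar c X_j^m, whose \<open>p\<close>-th power is c^p X_j^(p
  m).\<close>

lemma \<phi>_shift:
  assumes "c \<in> carrier R" "h \<in> carrier A" "j < n"
  shows "\<phi> (tmonom (c [^] p) (shift n j (p * m)) \<otimes>\<^bsub>A\<^esub> h) = tmonom c (shift n j m) \<otimes>\<^bsub>A\<^esub> \<phi> h"
  using \<phi> assms unfolding p_inv_linear_def
  by (metis (no_types, lifting) length_shift tmonom_closed tmonom_shift_pow)

lemma \<phi>_tmonom_shift:
  assumes "c \<in> carrier R" "length \<kappa> = n" "j < n" "length \<nu> = n"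
  shows "\<phi> (tmonom c (\<kappa>[j := \<kappa> ! j + p * m])) \<nu> =
    (if m \<le> \<nu> ! j then \<phi> (tmonom c \<kappa>) (\<nu>[j := \<nu> ! j - m]) else \<zero>)"
proof -
  have "tmonom c (\<kappa>[j := \<kappa> ! j + p * m]) = tmonom (\<one> [^] p) (shift n j (p * m)) \<otimes>\<^bsub>A\<^esub> tmonom c \<kappa>"
    using assms by (simp add: tmonom_shift_mult_tmonom)
  then have "\<phi> (tmonom c (\<kappa>[j := \<kappa> ! j + p * m])) = tmonom \<one> (shift n j m) \<otimes>\<^bsub>A\<^esub> \<phi> (tmonom c \<kappa>)"
    using assms by (simp only: \<phi>_shift tmonom_closed one_closed)
  then show ?thesis
    using assms by (simp add: tmonom_shift_mult \<phi>_closed \<phi>_coeff_closed tmonom_closed)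
qed

lemma \<phi>_divisible:
  assumes g: "g \<in> carrier A" and j: "j < n" and div: "\<And>\<mu>. g \<mu> \<noteq> \<zero> \<Longrightarrow> p * m \<le> \<mu> ! j"
    and \<nu>: "length \<nu> = n" "\<nu> ! j < m"
  shows "\<phi> g \<nu> = \<zero>"
proof -
  define h where "h = (\<lambda>\<mu>. if length \<mu> = n then g (\<mu>[j := \<mu> ! j + p * m]) else \<zero>)"
  have h: "h \<in> carrier A"
    unfolding carrier_tate_iff
  proof (intro conjI allI impI)
    fix e :: real assume "0 < e"
    then obtain N where N: "\<And>\<nu>. length \<nu> = n \<and> N \<le> sum_list \<nu> \<Longrightarrow> v (g \<nu>) < e"
      using g unfolding carrier_tate_iff by blast
    have "v (h \<mu>) < e" if "length \<mu> = n" "N \<le> sum_list \<mu>" for \<mu>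
      using that j by (auto simp: h_def sum_list_update intro!: N)
    then show "\<exists>N. \<forall>\<nu>. length \<nu> = n \<and> N \<le> sum_list \<nu> \<longrightarrow> v (h \<nu>) < e" by blast
  qed (use tate_coeff_closed[OF g] in \<open>auto simp: h_def\<close>)
  have "tmonom (\<one> [^] p) (shift n j (p * m)) \<otimes>\<^bsub>A\<^esub> h = g"
  proof
    fix \<mu>
    have "g \<mu> = \<zero>" if "\<not> p * m \<le> \<mu> ! j" using div that by blast
    then show "(tmonom (\<one> [^] p) (shift n j (p * m)) \<otimes>\<^bsub>A\<^esub> h) \<mu> = g \<mu>"
      using h j g tate_coeff_closed[OF g]
      by (subst tmonom_shift_mult) (auto simp: h_def carrier_tate_iff split: if_splits)
  qed
  then have "\<phi> g = tmonom \<one> (shift n j m) \<otimes>\<^bsub>A\<^esub> \<phi> h"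
    using \<phi>_shift[OF one_closed h j, of m] by simp
  then show ?thesis using \<nu> h j by (simp add: tmonom_shift_mult \<phi>_closed)
qed

lemma p_inv_linear_coeff:
  assumes e: "length e = n" and \<nu>: "length \<nu> = n"
  shows "p_inv_linear R p (\<lambda>a. \<phi> (tmonom a e) \<nu>)"
  unfolding p_inv_linear_def
proof (intro conjI ballI)
  show "\<phi> (tmonom a e) \<nu> \<in> carrier R" if "a \<in> carrier R" for a
    using that e by (simp add: \<phi>_coeff_closed tmonom_closed)
  show "\<phi> (tmonom (a \<oplus> b) e) \<nu> = \<phi> (tmonom a e) \<nu> \<oplus> \<phi> (tmonom b e) \<nu>"
    if "a \<in> carrier R" "b \<in> carrier R" for a b
  proof -
    have "tmonom (a \<oplus> b) e = tmonom a e \<oplus>\<^bsub>A\<^esub> tmonom b e" by (auto simp: tate_add tmonom_def)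
    then show ?thesis using that e by (simp add: \<phi>_add tmonom_closed)
  qed
  show "\<phi> (tmonom (r [^] p \<otimes> a) e) \<nu> = r \<otimes> \<phi> (tmonom a e) \<nu>"
    if "r \<in> carrier R" "a \<in> carrier R" for r a
  proof -
    \<comment> \<open>Constants are treated as monomials with the zeroth power of a variable, so
      that \<open>\<phi>_shift\<close> covers them; the index 0 is a valid one because
      \<open>n\<close> is positive.\<close>
    have "tmonom (r [^] p \<otimes> a) e = tmonom (r [^] p) (shift n 0 (p * 0)) \<otimes>\<^bsub>A\<^esub> tmonom a e"
      using that e n by (subst tmonom_shift_mult_tmonom) auto
    then have "\<phi> (tmonom (r [^] p \<otimes> a) e) = tmonom r (shift n 0 0) \<otimes>\<^bsub>A\<^esub> \<phi> (tmonom a e)"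
      using that e n by (simp only: \<phi>_shift tmonom_closed)
    then show ?thesis using that e n \<nu> by (simp add: tmonom_shift_mult \<phi>_closed tmonom_closed)
  qed
qed

text \<open>Automatic continuity: if \<open>a \<mapsto> \<phi> (a X\<^sup>e) \<nu>\<close> were unbounded near \<open>0\<close>, there would be a null
  sequence \<open>a i\<close> such that \<open>\<phi> (\<Sum>i. a i X\<^sub>1\<^bsup>p i\<^esup> X\<^sup>e)\<close>, which is formally
  \<open>\<Sum>i. X\<^sub>1\<^sup>i \<phi> (a i X\<^sup>e)\<close>, has infinitely many coefficients of absolute value at least \<open>1\<close>.\<close>

lemma coeff_continuous:
  assumes e: "length e = n" and \<nu>: "length \<nu> = n"
    and lower: "\<And>a d. a \<in> carrier R \<Longrightarrow> d < \<nu> ! 0 \<Longrightarrow> \<phi> (tmonom a e) (\<nu>[0 := d]) = \<zero>"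
  shows "\<exists>\<delta>>0. \<exists>B. \<forall>a\<in>carrier R. v a \<le> \<delta> \<longrightarrow> v (\<phi> (tmonom a e) \<nu>) \<le> B"
proof (rule ccontr)
  assume "\<not> ?thesis"
  then have unbounded: "\<exists>a\<in>carrier R. v a \<le> \<delta> \<and> B < v (\<phi> (tmonom a e) \<nu>)" if "0 < \<delta>" for \<delta> B
    using that by (meson not_le)
  define k where "k = \<nu> ! 0"
  define c where "c a d = \<phi> (tmonom a e) (\<nu>[0 := d])" for a d
  have ck: "c a k = \<phi> (tmonom a e) \<nu>" for a by (simp add: c_def k_def)
  have cc: "c a d \<in> carrier R" if "a \<in> carrier R" for a d
    using that e by (simp add: c_def \<phi>_coeff_closed tmonom_closed)
  \<comment> \<open>The coefficient at N + k of the final image receives c (a i) (N + k - i) from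
    each earlier term i < N. The new term is chosen to exceed the total of these by more than 1,
    while itself being at most 1 / (N + 1).\<close>
  define P where "P f N r \<longleftrightarrow> r \<in> carrier R \<and> v r \<le> 1 / Suc N \<and>
      1 + (\<Sum>i<N. \<bar>v (c (f i) (N + k - i))\<bar>) < v (c r k)" for f :: "nat \<Rightarrow> 'a" and N r
  have "\<exists>a. \<forall>N. P a N (a N)"
  proof (rule dependent_wf_choice[of less_than])
    fix f g :: "nat \<Rightarrow> 'a" and x r
    assume "\<And>z. (z, x) \<in> less_than \<Longrightarrow> f z = g z"
    then have "(\<Sum>i<x. \<bar>v (c (f i) (x + k - i))\<bar>) = (\<Sum>i<x. \<bar>v (c (g i) (x + k - i))\<bar>)"
      by (intro sum.cong) auto
    then show "P f x r = P g x r" by (simp add: P_def)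
  next
    fix x f
    show "\<exists>r. P f x r" unfolding P_def ck by (use unbounded[of "1 / Suc x"] in force)
  qed auto
  then obtain a where "\<And>N. P a N (a N)" by blast
  then have a: "a N \<in> carrier R" "v (a N) \<le> 1 / Suc N"
    and big: "1 + (\<Sum>i<N. \<bar>v (c (a i) (N + k - i))\<bar>) < v (c (a N) k)" for N
    by (auto simp: P_def)

  define \<kappa> where "\<kappa> i = e[0 := e ! 0 + p * i]" for i
  have \<kappa>: "length (\<kappa> i) = n" "\<kappa> i ! 0 = e ! 0 + p * i" "sum_list (\<kappa> i) = sum_list e + p * i" for i
    using e n by (simp_all add: \<kappa>_def sum_list_update)
  \<comment> \<open>The series with terms a i at the exponents \<kappa> i; the index i is recovered
    from the exponent of the first variable.\<close>
  define f where "f = (\<lambda>\<mu>. if \<mu> \<in> range \<kappa> then a ((\<mu> ! 0 - e ! 0) div p) else \<zero>)"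
  have f\<kappa>: "f (\<kappa> i) = a i" for i using p by (simp add: f_def \<kappa>)
  have f: "f \<in> carrier A"
    unfolding carrier_tate_iff
  proof (intro conjI allI impI)
    fix \<epsilon> :: real assume \<epsilon>: "0 < \<epsilon>"
    then obtain N where N: "1 / Suc N < \<epsilon>" using nat_approx_posE by blast
    have "v (f \<mu>) < \<epsilon>" if "sum_list e + p * N \<le> sum_list \<mu>" for \<mu>
    proof (cases "\<mu> \<in> range \<kappa>")
      case True
      then obtain i where i: "\<mu> = \<kappa> i" by blast
      then have "N \<le> i" using that p by (simp add: \<kappa>)
      then have "1 / real (Suc i) \<le> 1 / Suc N" by (simp add: field_simps)
      then show ?thesis using a(2)[of i] N by (simp add: i f\<kappa>)
    next
      case False
      then show ?thesis using \<epsilon> by (simp add: f_def v_zero)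
    qed
    then show "\<exists>N. \<forall>\<nu>. length \<nu> = n \<and> N \<le> sum_list \<nu> \<longrightarrow> v (f \<nu>) < \<epsilon>" by blast
  qed (use a \<kappa> in \<open>auto simp: f_def\<close>)

  define F where "F I = restr (\<kappa> ` I) f" for I
  have F: "F I \<in> carrier A" for I unfolding F_def by (rule restr_closed[OF f])
  have inj: "inj \<kappa>"
  proof (rule injI)
    fix i j assume "\<kappa> i = \<kappa> j"
    then have "\<kappa> i ! 0 = \<kappa> j ! 0" by simp
    then show "i = j" using p by (simp add: \<kappa>)
  qed
  have F_Un: "\<phi> (F (I \<union> J)) \<mu> = \<phi> (F I) \<mu> \<oplus> \<phi> (F J) \<mu>" if "I \<inter> J = {}" for I J \<mu>
  proof -
    have "\<kappa> ` I \<inter> \<kappa> ` J = {}" using that inj by (auto dest: injD)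
    then have "F (I \<union> J) = F I \<oplus>\<^bsub>A\<^esub> F J" unfolding F_def image_Un by (rule restr_Un[OF f])
    then show ?thesis by (simp add: \<phi>_add F)
  qed
  have F_single: "F {i} = tmonom (a i) (\<kappa> i)" for i
    by (auto simp: F_def restr_def tmonom_def f\<kappa>)
  have single: "\<phi> (F {i}) (\<nu>[0 := d]) = (if i \<le> d then c (a i) (d - i) else \<zero>)" for i d
    using \<phi>_tmonom_shift[of "a i" e 0 "\<nu>[0 := d]" i] a e \<nu> n
    by (simp add: F_single \<kappa>_def c_def)
  have F_Suc: "\<phi> (F {..<Suc m}) (\<nu>[0 := d]) =
      \<phi> (F {..<m}) (\<nu>[0 := d]) \<oplus> (if m \<le> d then c (a m) (d - m) else \<zero>)" for m d
    using F_Un[of "{..<m}" "{m}" "\<nu>[0 := d]"] by (simp add: single lessThan_Suc)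
  have "1 \<le> v (\<phi> f (\<nu>[0 := N + k]))" for N
  proof -
    let ?\<nu> = "\<nu>[0 := N + k]"
    have sum_ge_0: "0 \<le> (\<Sum>i<m. \<bar>v (c (a i) (N + k - i))\<bar>)" for m by (rule sum_nonneg) simp
    have small: "v (\<phi> (F {..<m}) ?\<nu>) \<le> (\<Sum>i<m. \<bar>v (c (a i) (N + k - i))\<bar>)" if "m \<le> N" for m
      using that
    proof (induction m)
      case 0
      have "\<phi> (F ({} \<union> {})) ?\<nu> = \<phi> (F {}) ?\<nu> \<oplus> \<phi> (F {}) ?\<nu>" by (rule F_Un) simp
      then have "\<phi> (F {}) ?\<nu> = \<zero>" using \<phi>_coeff_closed[OF F] by simp
      then show ?case by (simp add: v_zero)
    next
      case (Suc m)
      have "v (\<phi> (F {..<Suc m}) ?\<nu>) \<le> max (v (\<phi> (F {..<m}) ?\<nu>)) (v (c (a m) (N + k - m)))"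
        unfolding F_Suc using Suc.prems v_add[OF \<phi>_coeff_closed[OF F] cc[OF a(1)]] by simp
      also have "\<dots> \<le> (\<Sum>i<m. \<bar>v (c (a i) (N + k - i))\<bar>) + \<bar>v (c (a m) (N + k - m))\<bar>"
        using Suc.IH Suc.prems sum_ge_0[of m] by linarith
      finally show ?case by simp
    qed
    \<comment> \<open>The terms with N < i \<le> N + k contribute coefficients of index N + k - i <
      k, which vanish by \<open>lower\<close>. Without that hypothesis these later choices could
      cancel the large term.\<close>
    have tail: "\<phi> (F {..<Suc N + j}) ?\<nu> = \<phi> (F {..<Suc N}) ?\<nu>" if "j \<le> k" for j
      using that
    proof (induction j)
      case (Suc j)
      have "c (a (Suc N + j)) (N + k - (Suc N + j)) = \<zero>"
        unfolding c_def using Suc.prems a by (intro lower) (auto simp: k_def)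
      then show ?case using Suc \<phi>_coeff_closed[OF F] F_Suc[of "Suc N + j" "N + k"] by simp
    qed simp
    have "{..<Suc N + k} \<union> {Suc N + k..} = UNIV" by auto
    then have "f = F ({..<Suc N + k} \<union> {Suc N + k..})" by (auto simp: F_def restr_def f_def)
    then have "\<phi> f ?\<nu> = \<phi> (F ({..<Suc N + k} \<union> {Suc N + k..})) ?\<nu>" by (rule arg_cong)
    also have "\<dots> = \<phi> (F {..<Suc N + k}) ?\<nu> \<oplus> \<phi> (F {Suc N + k..}) ?\<nu>"
      by (rule F_Un) auto
    also have "\<phi> (F {Suc N + k..}) ?\<nu> = \<zero>"
    \<comment> \<open>All terms with i > N + k are handled at once: their sum is divisible by the
      power p (N + k + 1) of the first variable, so its image has no coefficient at N + k.\<close>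
    proof (rule \<phi>_divisible[OF F n, of _ "Suc N + k"])
      fix \<mu> assume "F {Suc N + k..} \<mu> \<noteq> \<zero>"
      then obtain i where "\<mu> = \<kappa> i" "Suc N + k \<le> i" by (auto simp: F_def restr_def split: if_splits)
      then show "p * (Suc N + k) \<le> \<mu> ! 0" using mult_le_mono2[of "Suc N + k" i p] by (simp add: \<kappa>)
    qed (use \<nu> n in auto)
    also have "\<phi> (F {..<Suc N + k}) ?\<nu> = \<phi> (F {..<N}) ?\<nu> \<oplus> c (a N) k"
      using tail[of k] F_Suc[of N "N + k"] by simp
    finally have eq: "\<phi> f ?\<nu> = \<phi> (F {..<N}) ?\<nu> \<oplus> c (a N) k"
      using \<phi>_coeff_closed[OF F] cc a by simp
    have "c (a N) k = \<phi> f ?\<nu> \<ominus> \<phi> (F {..<N}) ?\<nu>"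
    proof -
      have cancel: "y = x \<oplus> y \<ominus> x" if "x \<in> carrier R" "y \<in> carrier R" for x y
        using that by algebra
      show ?thesis unfolding eq by (rule cancel[OF \<phi>_coeff_closed[OF F] cc[OF a(1)]])
    qed
    then have "v (c (a N) k) \<le> max (v (\<phi> f ?\<nu>)) (v (\<phi> (F {..<N}) ?\<nu>))"
      using v_diff[OF \<phi>_coeff_closed[OF f] \<phi>_coeff_closed[OF F]] by simp
    then show ?thesis
      using big[of N] small[of N] sum_ge_0[of N] by linarith
  qed
  moreover obtain N where "\<And>\<mu>. length \<mu> = n \<Longrightarrow> N \<le> sum_list \<mu> \<Longrightarrow> v (\<phi> f \<mu>) < 1"
    using \<phi>_closed[OF f] unfolding carrier_tate_iff by (metis zero_less_one)
  moreover have "N \<le> sum_list (\<nu>[0 := N + k])"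
    using elem_le_sum_list[of 0 "\<nu>[0 := N + k]"] \<nu> n by simp
  ultimately show False using \<nu> by (metis length_list_update not_le)
qed

text \<open>On a single monomial, strong induction on the first entry of \<nu> provides the
  vanishing of lower coefficients required for continuity, and \<open>no_functional\<close> then
  applies. For a general series and a fixed \<nu>, all but finitely many exponents are too large in
  some variable to affect the coefficient at \<nu>, so only a finite sum of monomials
  remains.\<close>

theorem p_inv_linear_tate_eq_zero:
  assumes no_functional: "\<And>\<psi> \<delta> B. p_inv_linear R p \<psi> \<Longrightarrow> 0 < \<delta> \<Longrightarrow>
      (\<And>a. a \<in> carrier R \<Longrightarrow> v a \<le> \<delta> \<Longrightarrow> v (\<psi> a) \<le> B) \<Longrightarrow> \<forall>a\<in>carrier R. \<psi> a = \<zero>"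
    and f: "f \<in> carrier A"
  shows "\<phi> f = \<zero>\<^bsub>A\<^esub>"
proof -
  have mon: "\<phi> (tmonom a e) \<nu> = \<zero>" if "length e = n" "length \<nu> = n" "a \<in> carrier R" for a e \<nu>
    using that(2,3)
  proof (induction "\<nu> ! 0" arbitrary: \<nu> a rule: less_induct)
    case less
    have "\<exists>\<delta>>0. \<exists>B. \<forall>a\<in>carrier R. v a \<le> \<delta> \<longrightarrow> v (\<phi> (tmonom a e) \<nu>) \<le> B"
      by (rule coeff_continuous[OF that(1)]) (use less n in auto)
    then obtain \<delta> B where "0 < \<delta>" "\<And>a. a \<in> carrier R \<Longrightarrow> v a \<le> \<delta> \<Longrightarrow> v (\<phi> (tmonom a e) \<nu>) \<le> B" by blast
    from no_functional[OF p_inv_linear_coeff[OF that(1) less.prems(1)] this] less.prems(2)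
    show ?case by blast
  qed
  have empty: "\<phi> (restr {} f) \<nu> = \<zero>" for \<nu>
    using \<phi>_add[OF restr_closed[OF f] restr_closed[OF f], of "{}" "{}" \<nu>] restr_Un[OF f, of "{}" "{}"]
      \<phi>_coeff_closed[OF restr_closed[OF f]] by simp
  have step: "\<phi> (restr (D \<union> E) f) \<nu> = \<zero>"
    if "D \<inter> E = {}" "\<phi> (restr D f) \<nu> = \<zero>" "\<phi> (restr E f) \<nu> = \<zero>" for D E \<nu>
    using that by (simp add: restr_Un[OF f] \<phi>_add restr_closed[OF f])
  have fin: "\<phi> (restr D f) \<nu> = \<zero>"
    if "finite D" "D \<subseteq> {\<mu>. length \<mu> = n}" "length \<nu> = n" for D \<nu>
    using that
  proof (induction D rule: finite_induct)
    case (insert \<kappa> D)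
    have "restr {\<kappa>} f = tmonom (f \<kappa>) \<kappa>" by (auto simp: restr_def tmonom_def)
    then have "\<phi> (restr {\<kappa>} f) \<nu> = \<zero>"
      using insert.prems by (simp add: mon tate_coeff_closed[OF f])
    then show ?case using step[of D "{\<kappa>}" \<nu>] insert by simp
  qed (simp add: empty)
  have "\<phi> f \<nu> = \<zero>" if \<nu>: "length \<nu> = n" for \<nu>
  proof -
    \<comment> \<open>Exponents too large in one of the first \<open>j\<close> variables. Adding one
      variable at a time, with \<open>?E\<close> disjoint from the part already treated, makes each
      piece divisible by a power of a single variable, as \<open>\<phi>_divisible\<close>
      demands.\<close>
    define D where "D j = {\<mu>. \<exists>i<j. p * (\<nu> ! i + 1) \<le> \<mu> ! i}" for j
    have D: "\<phi> (restr (D j) f) \<nu> = \<zero>" if "j \<le> n" for j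
      using that
    proof (induction j)
      case 0
      then show ?case by (simp add: D_def empty)
    next
      case (Suc j)
      let ?E = "{\<mu>. p * (\<nu> ! j + 1) \<le> \<mu> ! j} - D j"
      have "D (Suc j) = D j \<union> ?E" by (auto simp: D_def less_Suc_eq)
      moreover have "\<phi> (restr ?E f) \<nu> = \<zero>"
        by (rule \<phi>_divisible[OF restr_closed[OF f], of j _ "\<nu> ! j + 1"])
           (use Suc \<nu> in \<open>auto simp: restr_def split: if_splits\<close>)
      ultimately show ?case using step[of "D j" ?E \<nu>] Suc by auto
    qed
    define G where "G = {\<mu>. length \<mu> = n} - D n"
    have "G \<subseteq> {xs. set xs \<subseteq> {..p * (sum_list \<nu> + 1)} \<and> length xs = n}"
    proof
      fix \<mu> assume \<mu>: "\<mu> \<in> G"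
      have "\<mu> ! i \<le> p * (sum_list \<nu> + 1)" if "i < n" for i
      proof -
        have "\<mu> ! i \<le> p * (\<nu> ! i + 1)" using \<mu> that by (auto simp: G_def D_def not_le less_imp_le)
        also have "\<dots> \<le> p * (sum_list \<nu> + 1)" using elem_le_sum_list[of i \<nu>] that \<nu> by simp
        finally show ?thesis .
      qed
      then show "\<mu> \<in> {xs. set xs \<subseteq> {..p * (sum_list \<nu> + 1)} \<and> length xs = n}"
        using \<mu> by (auto simp: G_def in_set_conv_nth)
    qed
    then have "finite G" by (rule finite_subset) (intro finite_lists_length_eq, simp)
    then have "\<phi> (restr G f) \<nu> = \<zero>" using \<nu> by (intro fin) (auto simp: G_def)
    then have "\<phi> (restr (D n \<union> G) f) \<nu> = \<zero>" using D[of n] by (intro step) (auto simp: G_def)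
    moreover have "restr (D n \<union> G) f = f"
      using f by (auto simp: restr_def G_def carrier_tate_iff fun_eq_iff)
    ultimately show ?thesis by simp
  qed
  then show ?thesis using \<phi>_closed[OF f] by (auto simp: tate_zero carrier_tate_iff fun_eq_iff)
qed

end

section \<open>The field\<close>

definition tame :: "nat \<Rightarrow> rat set \<Rightarrow> bool" where
  "tame p S \<longleftrightarrow> (\<forall>c>0. \<exists>F. finite F \<and> (\<forall>q\<in>S. c \<le> q \<longrightarrow> (\<exists>r\<in>F. \<exists>s>0. q = r * s ^ p)))"

lemma tameE:
  assumes "tame p S" "0 < c"
  obtains F where "finite F" "\<forall>q\<in>S. c \<le> q \<longrightarrow> (\<exists>r\<in>F. \<exists>s>0. q = r * s ^ p)"
proof -
  have "\<exists>F. finite F \<and> (\<forall>q\<in>S. c \<le> q \<longrightarrow> (\<exists>r\<in>F. \<exists>s>0. q = r * s ^ p))"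
    using assms by (simp add: tame_def)
  then obtain F where "finite F" "\<forall>q\<in>S. c \<le> q \<longrightarrow> (\<exists>r\<in>F. \<exists>s>0. q = r * s ^ p)" by (elim exE conjE)
  then show ?thesis by (rule that)
qed

lemma tame_subset: "tame p S \<Longrightarrow> T \<subseteq> S \<Longrightarrow> tame p T"
  unfolding tame_def by (meson subsetD)

lemma tame_Un:
  assumes "tame p S" "tame p T" shows "tame p (S \<union> T)"
  unfolding tame_def
proof (intro allI impI)
  fix c :: rat assume "0 < c"
  obtain F where F: "finite F" "\<forall>q\<in>S. c \<le> q \<longrightarrow> (\<exists>r\<in>F. \<exists>s>0. q = r * s ^ p)"
    by (rule tameE[OF assms(1) \<open>0 < c\<close>])
  obtain G where G: "finite G" "\<forall>q\<in>T. c \<le> q \<longrightarrow> (\<exists>r\<in>G. \<exists>s>0. q = r * s ^ p)"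
    by (rule tameE[OF assms(2) \<open>0 < c\<close>])
  have "\<exists>r\<in>F \<union> G. \<exists>s>0. q = r * s ^ p" if "q \<in> S \<union> T" "c \<le> q" for q
    using F(2) G(2) that by blast
  then show "\<exists>F. finite F \<and> (\<forall>q\<in>S \<union> T. c \<le> q \<longrightarrow> (\<exists>r\<in>F. \<exists>s>0. q = r * s ^ p))"
    using F(1) G(1) by blast
qed

lemma tame_finite: "finite S \<Longrightarrow> tame p S"
  unfolding tame_def by (intro allI impI exI[of _ S] conjI) (auto intro!: bexI exI[of _ 1])

text \<open>If x y \<ge> c and y \<le> b, then x \<ge> c / b, and symmetrically for y. So only
  finitely many cosets of each factor matter, and their products cover the cosets of x y. This is
  where upper bounds on the sets enter.\<close>

lemma tame_mult:
  assumes S: "tame p S" "S \<subseteq> {0<..a}" and T: "tame p T" "T \<subseteq> {0<..b}" and ab: "0 < a" "0 < b"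
  shows "tame p {x * y |x y. x \<in> S \<and> y \<in> T}"
  unfolding tame_def
proof (intro allI impI)
  fix c :: rat assume c: "0 < c"
  obtain F where F: "finite F" "\<forall>q\<in>S. c / b \<le> q \<longrightarrow> (\<exists>r\<in>F. \<exists>s>0. q = r * s ^ p)"
    by (rule tameE[OF S(1) divide_pos_pos[OF c ab(2)]])
  obtain G where G: "finite G" "\<forall>q\<in>T. c / a \<le> q \<longrightarrow> (\<exists>r\<in>G. \<exists>s>0. q = r * s ^ p)"
    by (rule tameE[OF T(1) divide_pos_pos[OF c ab(1)]])
  have "\<exists>r\<in>(\<lambda>(r, r'). r * r') ` (F \<times> G). \<exists>s>0. x * y = r * s ^ p"
    if xy: "x \<in> S" "y \<in> T" "c \<le> x * y" for x y
  proof -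
    have pos: "0 < x" "x \<le> a" "0 < y" "y \<le> b" using xy S T by auto
    have "c \<le> x * b" by (rule order_trans[OF xy(3) mult_left_mono]) (use pos in auto)
    then obtain r s where r: "r \<in> F" "0 < s" "x = r * s ^ p"
      using F(2)[rule_format, of x] xy ab by (auto simp: divide_le_eq)
    have "c \<le> a * y" by (rule order_trans[OF xy(3) mult_right_mono]) (use pos in auto)
    then obtain r' s' where r': "r' \<in> G" "0 < s'" "y = r' * s' ^ p"
      using G(2)[rule_format, of y] xy ab by (auto simp: divide_le_eq mult.commute)
    have "x * y = (r * r') * (s * s') ^ p" using r r' by (simp add: power_mult_distrib)
    then show ?thesis using r r' by (intro bexI[of _ "r * r'"] exI[of _ "s * s'"]) auto
  qed
  then show "\<exists>F. finite F \<and> (\<forall>q\<in>{x * y |x y. x \<in> S \<and> y \<in> T}. c \<le> q \<longrightarrow> (\<exists>r\<in>F. \<exists>s>0. q = r * s ^ p))"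
    using F(1) G(1) by (intro exI[of _ "(\<lambda>(r, r'). r * r') ` (F \<times> G)"]) auto
qed

lemma tame_locally:
  assumes "\<And>c. 0 < c \<Longrightarrow> \<exists>T. tame p T \<and> S \<inter> {c..} \<subseteq> T"
  shows "tame p S"
  unfolding tame_def
proof (intro allI impI)
  fix c :: rat assume c: "0 < c"
  then obtain T where T: "tame p T" "S \<inter> {c..} \<subseteq> T" using assms by blast
  obtain F where F: "finite F" "\<forall>q\<in>T. c \<le> q \<longrightarrow> (\<exists>r\<in>F. \<exists>s>0. q = r * s ^ p)"
    by (rule tameE[OF T(1) c])
  have "q \<in> T" if "q \<in> S" "c \<le> q" for q using T(2) that by auto
  then show "\<exists>F. finite F \<and> (\<forall>q\<in>S. c \<le> q \<longrightarrow> (\<exists>r\<in>F. \<exists>s>0. q = r * s ^ p))"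
    using F by blast
qed

text \<open>The ratio of \<open>1 + 1 / q\<close> and \<open>1 + 1 / r\<close>, for odd primes \<open>q < r\<close>, has \<open>r\<close>-adic valuation \<open>1\<close>.\<close>

lemma not_tame_odd_primes:
  fixes q :: "nat \<Rightarrow> nat"
  assumes p: "2 \<le> p" and q: "strict_mono q" "\<And>n. prime (q n)" "\<And>n. 2 < q n"
  shows "\<not> tame p (range (\<lambda>n. 1 + 1 / of_nat (q n)))"
proof
  define g :: "nat \<Rightarrow> rat" where "g n = 1 + 1 / of_nat (q n)" for n
  have qpos: "0 < q n" for n using q(3)[of n] by simp
  assume "tame p (range (\<lambda>n. 1 + 1 / of_nat (q n)))"
  then have "tame p (range g)" by (simp add: g_def[abs_def])
  then obtain F where F: "finite F" "\<forall>x\<in>range g. 1 \<le> x \<longrightarrow> (\<exists>r\<in>F. \<exists>s>0. x = r * s ^ p)"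
    by (rule tameE[OF _ zero_less_one])
  have "1 \<le> g n" for n by (simp add: g_def)
  then have "\<forall>n. \<exists>r. r \<in> F \<and> (\<exists>s>0. g n = r * s ^ p)" using F(2) by blast
  then obtain r where r: "\<And>n. r n \<in> F" "\<And>n. \<exists>s>0. g n = r n * s ^ p" by metis
  \<comment> \<open>Pigeonhole: all the numbers exceed 1, so finitely many coset representatives
    have to serve all of them, and two share one. Their ratio is then a \<open>p\<close>-th power of
    a positive rational.\<close>
  have "\<not> inj r"
    using F(1) r(1) by (metis finite_imageD finite_subset image_subsetI infinite_UNIV_nat)
  then obtain m n where "r m = r n" "m \<noteq> n" by (auto simp: inj_def)
  then obtain m n where mn: "m < n" "r m = r n" by (metis linorder_neqE_nat)
  obtain s where s: "0 < s" "g m = r m * s ^ p" using r(2) by blast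
  obtain t where t: "0 < t" "g n = r m * t ^ p" using r(2) mn by metis
  obtain a b where ab: "quotient_of (s / t) = (a, b)" by fastforce
  have b: "0 < b" and st: "s / t = of_int a / of_int b"
    using ab quotient_of_denom_pos quotient_of_div by auto
  have a: "0 < a"
  proof -
    have "0 < s / t" using s t by simp
    then show ?thesis using b unfolding st by (simp add: zero_less_divide_iff)
  qed
  have "s * of_int b = t * of_int a" using st s t b by (simp add: field_simps)
  then have "(s * of_int b) ^ p = (t * of_int a) ^ p" by simp
  then have "s ^ p * of_int b ^ p = t ^ p * of_int a ^ p" by (simp add: power_mult_distrib)
  then have "r m * s ^ p * of_int b ^ p = r m * t ^ p * of_int a ^ p" by simp
  then have "g m * of_int b ^ p = g n * of_int a ^ p" using s t by simp
  then have "of_nat (q m) * of_nat (q n) * (g m * of_int b ^ p) =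
      of_nat (q m) * of_nat (q n) * (g n * of_int a ^ p)" by simp
  moreover have "of_nat (q k) * g k = of_nat (q k + 1)" for k
    using qpos[of k] by (simp add: g_def field_simps)
  ultimately have "of_nat (q n) * of_nat (q m + 1) * (of_int b :: rat) ^ p =
      of_nat (q m) * of_nat (q n + 1) * of_int a ^ p"
    by (metis (no_types, opaque_lifting) mult.assoc mult.left_commute)
  then have "(of_int (int (q n) * int (q m + 1) * b ^ p) :: rat) = of_int (int (q m) * int (q n + 1) * a ^ p)"
    by simp
  then have eq: "int (q n) * int (q m + 1) * b ^ p = int (q m) * int (q n + 1) * a ^ p"
    by (simp only: of_int_eq_iff)
  have lt: "q m < q n" using q(1) mn by (simp add: strict_mono_less)
  have pr: "prime (int (q n))" using q(2) by simp
  have "\<not> q n dvd q m + 1"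
  proof
    assume "q n dvd q m + 1"
    then have "q n = q m + 1" using lt dvd_imp_le[of "q n" "q m + 1"] by simp
    \<comment> \<open>A prime \<open>q n > q m\<close> dividing \<open>q m + 1\<close> would equal
      it, which parity excludes for odd primes.\<close>
    moreover have "odd (q k)" for k using q(2,3) by (simp add: prime_odd_nat)
    ultimately show False by (metis even_plus_one_iff)
  qed
  then have n1: "\<not> int (q n) dvd int (q m + 1)" by (simp only: int_dvd_int_iff not_False_eq_True)
  have "\<not> q n dvd q m" using lt qpos[of m] by (auto dest: dvd_imp_le)
  then have n2: "\<not> int (q n) dvd int (q m)" by (simp only: int_dvd_int_iff not_False_eq_True)
  have "\<not> q n dvd 1" using q(3)[of n] by simp
  then have "\<not> q n dvd q n + 1" by (metis dvd_add_right_iff dvd_refl)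
  then have n3: "\<not> int (q n) dvd int (q n + 1)" by (simp only: int_dvd_int_iff not_False_eq_True)
  have nz: "int (q n) \<noteq> 0" "int (q m + 1) \<noteq> 0" "int (q m) \<noteq> 0" "int (q n + 1) \<noteq> 0" "a \<noteq> 0" "b \<noteq> 0"
    using qpos[of m] qpos[of n] a b by auto
  have pe: "prime_elem (int (q n))" using pr by simp
  have "multiplicity (int (q n)) (int (q n) * int (q m + 1) * b ^ p) = 1 + p * multiplicity (int (q n)) b"
    using nz pe not_dvd_imp_multiplicity_0[OF n1] multiplicity_self[of "int (q n)"] prime_elem_not_unit[OF pe]
    by (simp add: prime_elem_multiplicity_mult_distrib prime_elem_multiplicity_power_distrib del: of_nat_add)
  moreover have "multiplicity (int (q n)) (int (q m) * int (q n + 1) * a ^ p) = p * multiplicity (int (q n)) a"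
    using nz pe not_dvd_imp_multiplicity_0[OF n2] not_dvd_imp_multiplicity_0[OF n3]
    by (simp add: prime_elem_multiplicity_mult_distrib prime_elem_multiplicity_power_distrib del: of_nat_add)
  ultimately have "1 + p * multiplicity (int (q n)) b = p * multiplicity (int (q n)) a" using eq by simp
  then have "p dvd 1" by (metis dvd_add_left_iff dvd_triv_left)
  then show False using p by simp
qed

text \<open>The field has to live on the type \<open>real set\<close>. A series is a function
  between countable sets, so its graph can be coded by a set of natural numbers, viewed as reals,
  which determines the series.\<close>

definition enc :: "hahn \<Rightarrow> real set" where
  "enc x = range (\<lambda>q. real (to_nat (q, coeff x q)))"

definition dec :: "real set \<Rightarrow> hahn" where
  "dec = inv_into UNIV enc"

lemma dec_enc [simp]: "dec (enc x) = x"
proof -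
  have "inj enc"
  proof (rule injI)
    fix x y assume "enc x = enc y"
    show "x = y"
    proof (rule hahn_eqI)
      fix q
      have "real (to_nat (q, coeff x q)) \<in> enc x" by (simp add: enc_def)
      then have "real (to_nat (q, coeff x q)) \<in> enc y" using \<open>enc x = enc y\<close> by simp
      then show "coeff x q = coeff y q" by (auto simp: enc_def)
    qed
  qed
  then show ?thesis by (simp add: dec_def)
qed

lemma enc_eq_iff [simp]: "enc x = enc y \<longleftrightarrow> x = y"
  by (metis dec_enc)

section \<open>The complete field k and its spherically complete part L\<close>

locale hahn_mod =
  fixes p :: nat
  assumes prime: "prime p"
begin

definition K :: "hahn set" where
  "K = {x. red p x = x \<and> tame p (supp x)}"

definition L :: "hahn set" where
  "L = {x. red p x = x \<and> supp x \<subseteq> {s ^ p |s. 0 < s}}"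

definition k :: "real set ring" where
  "k = \<lparr>carrier = enc ` K, mult = (\<lambda>a b. enc (red p (dec a * dec b))), one = enc 1,
        zero = enc 0, add = (\<lambda>a b. enc (red p (dec a + dec b)))\<rparr>"

definition val :: "real set \<Rightarrow> real" where
  "val a = nrm (dec a)"

lemma p_gt_1: "1 < p"
  using prime by (rule prime_gt_1_nat)

lemma red_0 [simp]: "red p 0 = 0"
  by (rule hahn_eqI) (simp add: coeff_red)

lemma red_1 [simp]: "red p 1 = 1"
  using p_gt_1 by (intro hahn_eqI) (simp add: coeff_red coeff_1)

lemma K_red: "x \<in> K \<Longrightarrow> red p x = x"
  by (simp add: K_def)

lemma red_in_K: "tame p (supp x) \<Longrightarrow> red p x \<in> K"
  using supp_red tame_subset by (auto simp: K_def)

lemma K_add: "x \<in> K \<Longrightarrow> y \<in> K \<Longrightarrow> red p (x + y) \<in> K"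
  by (rule red_in_K, rule tame_subset[of p "supp x \<union> supp y"])
     (auto simp: K_def in_supp_iff intro: tame_Un)

lemma K_uminus: "x \<in> K \<Longrightarrow> red p (- x) \<in> K"
  by (rule red_in_K) (auto simp: K_def supp_def)

lemma K_mult:
  assumes "x \<in> K" "y \<in> K" shows "red p (x * y) \<in> K"
proof (rule red_in_K)
  show "tame p (supp (x * y))"
  proof (cases "x = 0 \<or> y = 0")
    case True
    then have "x * y = 0" by auto
    then show ?thesis by (simp add: supp_def tame_finite)
  next
    case False
    then have "tame p (supp_mult x y)"
      unfolding supp_mult_def using assms lead[of x] lead[of y]
      by (intro tame_mult[of p _ "lead x" _ "lead y"]) (auto simp: K_def supp_pos)
    then show ?thesis using supp_mult_subset tame_subset by blast
  qed
qed

lemma K_0: "0 \<in> K" and K_1: "1 \<in> K"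
  by (auto simp: K_def supp_def coeff_1 tame_finite)

lemma K_monom: "0 < q \<Longrightarrow> red p (monom c q) \<in> K"
  by (rule red_in_K, rule tame_subset[OF tame_finite[of "{q}"]])
     (auto simp: in_supp_iff coeff_monom split: if_splits)

lemma L_subset_K: "L \<subseteq> K"
  unfolding L_def K_def tame_def by (fastforce intro!: exI[of _ "{1}"])

lemma k_simps:
  "carrier k = enc ` K" "\<one>\<^bsub>k\<^esub> = enc 1" "\<zero>\<^bsub>k\<^esub> = enc 0"
  "enc x \<otimes>\<^bsub>k\<^esub> enc y = enc (red p (x * y))" "enc x \<oplus>\<^bsub>k\<^esub> enc y = enc (red p (x + y))"
  by (simp_all add: k_def)

lemma val_enc [simp]: "val (enc x) = nrm x"
  by (simp add: val_def)

lemma cring_k: "cring k"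
proof (rule cringI)
  show "abelian_group k"
  proof (rule abelian_groupI)
    fix x assume "x \<in> carrier k"
    then show "\<exists>y\<in>carrier k. y \<oplus>\<^bsub>k\<^esub> x = \<zero>\<^bsub>k\<^esub>"
      by (auto simp: k_simps red_simps intro!: bexI[OF _ K_uminus])
  qed (auto simp: k_simps red_simps K_add K_0 K_red add_ac)
  show "comm_monoid k"
    by (rule comm_monoidI) (auto simp: k_simps red_simps K_mult K_1 K_red mult_ac)
  fix x y z assume "x \<in> carrier k" "y \<in> carrier k" "z \<in> carrier k"
  then show "(x \<oplus>\<^bsub>k\<^esub> y) \<otimes>\<^bsub>k\<^esub> z = x \<otimes>\<^bsub>k\<^esub> z \<oplus>\<^bsub>k\<^esub> y \<otimes>\<^bsub>k\<^esub> z"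
    by (auto simp: k_simps red_simps distrib_right)
qed

sublocale k: cring k
  by (rule cring_k)

lemma k_uminus: "x \<in> K \<Longrightarrow> \<ominus>\<^bsub>k\<^esub> enc x = enc (red p (- x))"
  by (rule k.minus_equality) (auto simp: k_simps red_simps K_uminus)

lemma k_minus: "x \<in> K \<Longrightarrow> y \<in> K \<Longrightarrow> enc x \<ominus>\<^bsub>k\<^esub> enc y = enc (red p (x - y))"
  by (simp add: a_minus_def k_uminus k_simps red_simps)

lemma k_pow: "enc x [^]\<^bsub>k\<^esub> (n::nat) = enc (red p (x ^ n))"
  by (induction n) (auto simp: k_simps red_simps mult.commute)

text \<open>Only the two leading terms contribute to the coefficient at the product of the leading
  exponents. It is a product of two integers prime to \<open>p\<close>, hence survives
  reduction.\<close>

lemma nrm_mult: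
  assumes "x \<in> K" "y \<in> K" shows "nrm (red p (x * y)) = nrm x * nrm y"
proof (cases "x = 0 \<or> y = 0")
  case True
  then have "x * y = 0" by auto
  then show ?thesis using True by (auto simp: nrm_def)
next
  case False
  then have nz: "x \<noteq> 0" "y \<noteq> 0" by auto
  have "coeff (x * y) (lead x * lead y) = coeff x (lead x) * coeff y (lead y)"
  proof (subst coeff_mult_superset[of "{(lead x, lead y)}"])
    fix a b assume ab: "coeff x a \<noteq> 0" "coeff y b \<noteq> 0" "a * b = lead x * lead y"
    then have le: "0 < a" "a \<le> lead x" "0 < b" "b \<le> lead y"
      using lead[OF nz(1)] lead[OF nz(2)] supp_pos by (auto simp: in_supp_iff)
    have "a = lead x"
    proof (rule ccontr)
      assume "a \<noteq> lead x"
      then have "a * b < lead x * lead y" using le by (intro mult_less_le_imp_less) auto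
      then show False using ab by simp
    qed
    then show "(a, b) \<in> {(lead x, lead y)}" using ab le by auto
  qed auto
  moreover have "\<not> int p dvd coeff z (lead z)" if "z \<in> K" "z \<noteq> 0" for z
  proof -
    have "coeff z (lead z) mod int p = coeff z (lead z)" using K_red[OF that(1)] by (metis coeff_red)
    moreover have "coeff z (lead z) \<noteq> 0" using lead[OF that(2)] by (simp add: in_supp_iff)
    ultimately show ?thesis by (metis dvd_imp_mod_0)
  qed
  ultimately have "\<not> int p dvd coeff (x * y) (lead x * lead y)"
    using assms nz prime by (simp add: prime_dvd_mult_iff)
  then have "lead x * lead y \<in> supp (red p (x * y))"
    by (auto simp: in_supp_iff coeff_red)
  moreover have "r \<le> lead x * lead y" if "r \<in> supp (red p (x * y))" for r
  proof -
    have "r \<in> supp_mult x y" using that supp_red supp_mult_subset by blast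
    then show ?thesis using lead[OF nz(1)] lead[OF nz(2)]
      by (auto simp: supp_mult_def supp_pos less_imp_le intro!: mult_mono)
  qed
  ultimately have "nrm (red p (x * y)) = of_rat (lead x * lead y)" by (rule nrm_eqI)
  then show ?thesis using nz by (simp add: nrm_def of_rat_mult)
qed

lemma nonarch_abs_k: "nonarch_abs k val"
  unfolding nonarch_abs_def
proof (intro conjI ballI)
  fix a b assume "a \<in> carrier k" "b \<in> carrier k"
  then obtain x y where xy: "x \<in> K" "y \<in> K" "a = enc x" "b = enc y" by (auto simp: k_simps)
  show "val (a \<otimes>\<^bsub>k\<^esub> b) = val a * val b" using xy by (simp add: k_simps nrm_mult)
  have "nrm (red p (x + y)) \<le> max (nrm x) (nrm y)"
  proof (subst nrm_le_iff)
    show "0 \<le> max (nrm x) (nrm y)" using nrm_nonneg[of x] by simp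
    have "supp (red p (x + y)) \<subseteq> supp x \<union> supp y"
      by (rule order_trans[OF supp_red]) (auto simp: in_supp_iff)
    then show "\<forall>q\<in>supp (red p (x + y)). of_rat q \<le> max (nrm x) (nrm y)"
      using nrm_le_iff[OF nrm_nonneg, of x x] nrm_le_iff[OF nrm_nonneg, of y y]
      by (auto simp: le_max_iff_disj)
  qed
  then show "val (a \<oplus>\<^bsub>k\<^esub> b) \<le> max (val a) (val b)" using xy by (simp add: k_simps)
qed (auto simp: k_simps nrm_nonneg nrm_eq_0_iff)

sublocale k: nonarch_ring k val
  by unfold_locales (auto simp: nonarch_abs_k k_simps)

lemma in_supp_red_diff_iff:
  assumes "x \<in> K" "y \<in> K" shows "q \<in> supp (red p (x - y)) \<longleftrightarrow> coeff x q \<noteq> coeff y q"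
proof -
  have "coeff x q mod int p = coeff x q" "coeff y q mod int p = coeff y q"
    using assms K_red by (metis coeff_red)+
  then show ?thesis
    by (simp add: in_supp_iff coeff_red) (metis mod_eq_dvd_iff mod_0_imp_dvd dvd_imp_mod_0)
qed

text \<open>Elements of \<open>K\<close> have reduced coefficients, so congruent ones are equal and
  distances can be read off from where two series agree. The limit arguments use this and the
  nonstrict version below.\<close>

lemma val_diff_less_iff:
  "x \<in> K \<Longrightarrow> y \<in> K \<Longrightarrow> 0 < e \<Longrightarrow>
    val (enc x \<ominus>\<^bsub>k\<^esub> enc y) < e \<longleftrightarrow> (\<forall>q. e \<le> of_rat q \<longrightarrow> coeff x q = coeff y q)"
  by (simp add: k_minus nrm_less_iff Ball_def in_supp_red_diff_iff) (meson not_le)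

lemma val_diff_le_iff:
  "x \<in> K \<Longrightarrow> y \<in> K \<Longrightarrow> 0 \<le> e \<Longrightarrow>
    val (enc x \<ominus>\<^bsub>k\<^esub> enc y) \<le> e \<longleftrightarrow> (\<forall>q. e < of_rat q \<longrightarrow> coeff x q = coeff y q)"
  by (simp add: k_minus nrm_le_iff Ball_def in_supp_red_diff_iff) (meson not_le)

text \<open>In a Cauchy sequence the coefficients at all exponents above a given positive bound are
  eventually constant together, so the limit is formed coefficientwise. Well-ordered support and
  tameness are both tested above positive bounds, where the limit agrees with a term of the
  sequence.\<close>

lemma abs_complete_k: "abs_complete k val"
  unfolding abs_complete_def
proof (intro allI impI, elim conjE)
  fix s :: "nat \<Rightarrow> real set"
  assume s: "\<forall>i. s i \<in> carrier k"
    and cauchy: "\<forall>e>0. \<exists>N. \<forall>i\<ge>N. \<forall>j\<ge>N. val (s i \<ominus>\<^bsub>k\<^esub> s j) < e"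
  define X where "X i = dec (s i)" for i
  have X: "X i \<in> K" "s i = enc (X i)" for i using s unfolding X_def k_simps by (metis dec_enc imageE)+
  have ex: "\<exists>N. \<forall>i\<ge>N. \<forall>q\<ge>c. coeff (X i) q = coeff (X N) q" if c: "0 < c" for c
  proof -
    have c': "0 < (of_rat c :: real)" using c by simp
    have "\<exists>N. \<forall>i\<ge>N. \<forall>j\<ge>N. val (s i \<ominus>\<^bsub>k\<^esub> s j) < of_rat c"
      by (rule cauchy[THEN spec, THEN mp, OF c'])
    then obtain N where N: "\<forall>i\<ge>N. \<forall>j\<ge>N. val (s i \<ominus>\<^bsub>k\<^esub> s j) < of_rat c" ..
    have "coeff (X i) q = coeff (X N) q" if "N \<le> i" "c \<le> q" for i q
    proof -
      have "val (s i \<ominus>\<^bsub>k\<^esub> s N) < of_rat c" using N that(1) by simp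
      then show ?thesis using that(2) c' by (simp add: X val_diff_less_iff of_rat_less_eq)
    qed
    then show ?thesis by blast
  qed
  have "\<forall>c. \<exists>N. 0 < c \<longrightarrow> (\<forall>i\<ge>N. \<forall>q\<ge>c. coeff (X i) q = coeff (X N) q)"
    by (intro allI) (simp add: ex)
  then obtain N where N: "\<And>c i q. 0 < c \<Longrightarrow> N c \<le> i \<Longrightarrow> c \<le> q \<Longrightarrow> coeff (X i) q = coeff (X (N c)) q"
    by metis
  define f where "f q = (if 0 < q then coeff (X (N q)) q else 0)" for q
  have f: "f q = coeff (X i) q" if "0 < c" "N c \<le> i" "c \<le> q" for c i q
  proof -
    have "coeff (X (max i (N q))) q = coeff (X i) q" using N[OF that(1) _ that(3)] that(2)
      by (metis le_max_iff_disj order_refl)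
    moreover have "coeff (X (max i (N q))) q = coeff (X (N q)) q" using N[of q "max i (N q)" q] that by simp
    ultimately show ?thesis using that by (simp add: f_def)
  qed
  define l where "l = Abs_hahn f"
  have l: "coeff l = f"
    unfolding l_def
  proof (rule coeff_Abs_hahn_locally)
    fix c assume "f c \<noteq> 0"
    then have "0 < c" by (simp add: f_def split: if_splits)
    then show "\<exists>x. \<forall>q\<ge>c. f q = coeff x q" using f[of c "N c"] by blast
  qed (simp add: f_def)
  have "tame p (supp l)"
  proof (rule tame_locally)
    fix c :: rat assume "0 < c"
    then have "supp l \<inter> {c..} \<subseteq> supp (X (N c))" using f[of c "N c"] by (auto simp: in_supp_iff l)
    then show "\<exists>T. tame p T \<and> supp l \<inter> {c..} \<subseteq> T" using X(1)[of "N c"] by (auto simp: K_def)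
  qed
  moreover have "red p l = l"
  proof (rule hahn_eqI)
    fix q
    have "coeff (X (N q)) q mod int p = coeff (X (N q)) q" using K_red[OF X(1)] by (metis coeff_red)
    then show "coeff (red p l) q = coeff l q" by (simp add: coeff_red l f_def)
  qed
  ultimately have lK: "l \<in> K" by (simp add: K_def)
  have "\<exists>N. \<forall>i\<ge>N. val (s i \<ominus>\<^bsub>k\<^esub> enc l) < e" if e: "0 < e" for e
  proof -
    obtain c :: rat where c: "0 < c" "of_rat c < e" using of_rat_dense[OF e] by auto
    have "val (s i \<ominus>\<^bsub>k\<^esub> enc l) < e" if "N c \<le> i" for i
      unfolding X(2) val_diff_less_iff[OF X(1) lK e] l
    proof (intro allI impI)
      fix q assume "e \<le> of_rat q"
      then have "c \<le> q" using c(2) by (metis less_imp_le of_rat_less order_less_le_trans)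
      then show "coeff (X i) q = f q" using f c that by simp
    qed
    then show ?thesis by blast
  qed
  then show "\<exists>l\<in>carrier k. \<forall>e>0. \<exists>N. \<forall>i\<ge>N. val (s i \<ominus>\<^bsub>k\<^esub> l) < e"
    using lK by (intro bexI[of _ "enc l"]) (auto simp: k_simps)
qed

text \<open>The inverse of the leading term alone is a good enough approximation: multiplied by it,
  x agrees with 1 at all exponents at least 1.\<close>

lemma field_k: "field k"
proof (rule k.field_if_approx_inverses[OF abs_complete_k])
  fix a assume "a \<in> carrier k" "a \<noteq> \<zero>\<^bsub>k\<^esub>"
  then obtain x where x: "x \<in> K" "x \<noteq> 0" "a = enc x" by (auto simp: k_simps)
  define c where "c = coeff x (lead x)"
  have "c mod int p = c" unfolding c_def using K_red[OF x(1)] by (metis coeff_red)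
  moreover have "c \<noteq> 0" using lead[OF x(2)] by (simp add: c_def in_supp_iff)
  ultimately have "\<not> int p dvd c" by (metis dvd_imp_mod_0)
  then have "coprime (int p) c" using prime by (intro prime_imp_coprime) auto
  \<comment> \<open>By Bezout, \<open>d\<close> is an inverse of the leading coefficient modulo
    \<open>p\<close>.\<close>
  then obtain d e where de: "d * c + e * int p = 1" using bezout_int[of c "int p"]
    by (metis coprime_commute coprime_iff_gcd_eq_1)
  define y where "y = monom d (1 / lead x)"
  have y: "red p y \<in> K" unfolding y_def using lead[OF x(2)] by (intro K_monom) simp
  have "val (a \<otimes>\<^bsub>k\<^esub> enc (red p y) \<ominus>\<^bsub>k\<^esub> \<one>\<^bsub>k\<^esub>) < 1"
    unfolding x k_simps red_simps
  proof (subst val_diff_less_iff)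
    show "red p (x * y) \<in> K" using K_mult[OF x(1) y] by (simp add: red_simps)
    show "\<forall>q. 1 \<le> (of_rat q :: real) \<longrightarrow> coeff (red p (x * y)) q = coeff 1 q"
    proof (intro allI impI)
      fix q :: rat assume "1 \<le> (of_rat q :: real)"
      then have q: "1 \<le> q" by (metis of_rat_1 of_rat_less_eq)
      have "coeff (x * y) q = d * coeff x (q * lead x)"
        using lead[OF x(2)] by (simp add: y_def mult.commute[of x] coeff_monom_mult)
      moreover have "d * coeff x (lead x) mod int p = 1"
      proof -
        have "d * c = 1 + int p * (- e)" using de by (simp add: algebra_simps)
        then have "d * c mod int p = 1 mod int p" by (metis mod_mult_self2)
        then show ?thesis using p_gt_1 by (simp add: c_def)
      qed
      moreover have "coeff x (q * lead x) = 0" if "q \<noteq> 1"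
      proof (rule ccontr)
        assume "coeff x (q * lead x) \<noteq> 0"
        then have "q * lead x \<le> 1 * lead x" using lead[OF x(2)] by (simp add: in_supp_iff)
        then show False using lead(3)[OF x(2)] q that by simp
      qed
      ultimately show "coeff (red p (x * y)) q = coeff 1 q" by (auto simp: coeff_red coeff_1)
    qed
  qed (auto simp: K_1)
  then show "\<exists>b\<in>carrier k. val (a \<otimes>\<^bsub>k\<^esub> b \<ominus>\<^bsub>k\<^esub> \<one>\<^bsub>k\<^esub>) < 1"
    using y by (intro bexI[of _ "enc (red p y)"]) (auto simp: k_simps)
qed

sublocale k: nonarch_field k val
  by (intro nonarch_field.intro field_k k.nonarch_ring_axioms)

lemma ring_char_k: "ring_char_is k p"
proof -
  have add_pow: "add_pow k m \<one>\<^bsub>k\<^esub> = enc (red p (of_nat m))" for m :: nat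
    by (induction m) (auto simp: k_simps red_simps add.commute)
  have "coeff (of_nat m) q = int m * coeff 1 q" for m q
    using coeff_of_nat_mult[of m 1 q] by simp
  then have "red p (of_nat m) = 0 \<longleftrightarrow> p dvd m" for m
    by (subst hahn_eq_iff) (auto simp: coeff_red coeff_1)
  then show ?thesis
    unfolding ring_char_is_def add_pow using p_gt_1 by (auto simp: k_simps dest: dvd_imp_le)
qed

lemma val_dense:
  assumes "0 < x" "x < y" shows "\<exists>r\<in>carrier k. x < val r \<and> val r < y"
proof -
  obtain q where q: "x < of_rat q" "of_rat q < y" using of_rat_dense[OF assms(2)] by blast
  then have "0 < q" using assms(1) by (metis less_trans zero_less_of_rat_iff)
  then have "nrm (red p (monom 1 q)) = of_rat q"
    using p_gt_1 by (intro nrm_eqI) (auto simp: in_supp_iff coeff_red coeff_monom split: if_splits)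
  then show ?thesis using q K_monom[OF \<open>0 < q\<close>, of 1] by (intro bexI[of _ "enc (red p (monom 1 q))"]) (auto simp: k_simps)
qed

lemma complete_nonarch_field_k: "complete_nonarch_field k val"
proof -
  obtain r where "r \<in> carrier k" "2 < val r" using val_dense[of 2 3] by auto
  then have "abs_nontrivial k val" unfolding abs_nontrivial_def
    by (intro bexI[of _ r]) (auto simp: k.v_zero)
  then show ?thesis
    by (simp add: complete_nonarch_field_def field_k nonarch_abs_k abs_complete_k)
qed

text \<open>The radii need not tend to 0, so completeness does not apply. The pseudo-limit takes its
  coefficient at q from any term whose radius is below q. Its support stays inside the single coset
  of \<open>p\<close>-th powers; the same construction in \<open>K\<close> could meet infinitely
  many cosets above a positive bound.\<close>

lemma L_spherically_complete:
  assumes X: "\<And>n::nat. X n \<in> enc ` L" and r: "\<And>n. 0 < r n"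
    and le: "\<And>m n. n \<le> m \<Longrightarrow> val (X m \<ominus>\<^bsub>k\<^esub> X n) \<le> r n"
  shows "\<exists>l\<in>enc ` L. \<forall>n. val (l \<ominus>\<^bsub>k\<^esub> X n) \<le> r n"
proof -
  define Y where "Y n = dec (X n)" for n
  have Y: "Y n \<in> L" "X n = enc (Y n)" for n using X unfolding Y_def by (metis dec_enc imageE)+
  have YK: "Y n \<in> K" for n using Y L_subset_K by blast
  have agree: "coeff (Y m) q = coeff (Y n) q" if "n \<le> m" "r n < of_rat q" for m n q
    using le[OF that(1)] that(2) less_imp_le[OF r[of n]] by (simp add: Y val_diff_le_iff YK)
  \<comment> \<open>\<open>LEAST\<close> merely selects one admissible index. Exponents below or
    equal to every radius are unconstrained and get 0, which keeps the support well-ordered.\<close>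
  define f where "f q = (if \<exists>n. r n < of_rat q then coeff (Y (LEAST n. r n < of_rat q)) q else 0)" for q
  have f: "f q = coeff (Y n) q" if "r n < of_rat q" for n q
    using that agree[OF Least_le[of "\<lambda>n. r n < of_rat q", OF that] LeastI[of "\<lambda>n. r n < of_rat q", OF that]]
    by (auto simp: f_def)
  have f0: "\<exists>n. r n < of_rat q" if "f q \<noteq> 0" for q using that by (metis f_def)
  define l where "l = Abs_hahn f"
  have l: "coeff l = f"
    unfolding l_def
  proof (rule coeff_Abs_hahn_locally)
    fix q :: rat assume "q \<le> 0"
    then have "(of_rat q :: real) \<le> 0" by simp
    then have "\<not> r n < of_rat q" for n using r[of n] by linarith
    then show "f q = 0" using f0 by blast
  next
    fix c assume "f c \<noteq> 0"
    then obtain n where n: "r n < of_rat c" using f0 by blast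
    have "f q = coeff (Y n) q" if "c \<le> q" for q
      using n that by (intro f) (meson less_le_trans of_rat_less_eq)
    then show "\<exists>x. \<forall>q\<ge>c. f q = coeff x q" by blast
  qed
  have "supp l \<subseteq> {s ^ p |s. 0 < s}"
  proof
    fix q assume q: "q \<in> supp l"
    then obtain n where "r n < of_rat q" using f0 by (auto simp: in_supp_iff l)
    then have "q \<in> supp (Y n)" using q f by (simp add: in_supp_iff l)
    then show "q \<in> {s ^ p |s. 0 < s}" using Y(1)[of n] by (auto simp: L_def)
  qed
  moreover have "red p l = l"
  proof (rule hahn_eqI)
    fix q
    have "coeff (Y n) q mod int p = coeff (Y n) q" for n using K_red[OF YK] by (metis coeff_red)
    then show "coeff (red p l) q = coeff l q" by (simp add: coeff_red l f_def)
  qed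
  ultimately have lL: "l \<in> L" by (simp add: L_def)
  then have lK: "l \<in> K" using L_subset_K by blast
  have "val (enc l \<ominus>\<^bsub>k\<^esub> X n) \<le> r n" for n
    unfolding Y(2) using val_diff_le_iff[OF lK YK less_imp_le[OF r]] f by (simp add: l)
  then show ?thesis using lL by blast
qed

theorem continuous_p_inv_linear_k_eq_zero:
  assumes \<psi>: "p_inv_linear k p \<psi>" and \<delta>: "0 < \<delta>"
    and cont: "\<And>a. a \<in> carrier k \<Longrightarrow> val a \<le> \<delta> \<Longrightarrow> val (\<psi> a) \<le> B"
    and a: "a \<in> carrier k"
  shows "\<psi> a = \<zero>\<^bsub>k\<^esub>"
proof -
  have "infinite ({q::nat. prime q} - {..2})" using primes_infinite by (intro Diff_infinite_finite) auto
  then obtain q :: "nat \<Rightarrow> nat" where q: "strict_mono q" "\<And>n. q n \<in> {q. prime q} - {..2}"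
    using infinite_enumerate by blast
  then have q_prime: "prime (q n)" and q_gt: "2 < q n" for n by (auto simp: not_le)
  define \<gamma> :: "nat \<Rightarrow> rat" where "\<gamma> n = 1 + 1 / of_nat (q n)" for n
  have \<gamma>_pos: "0 < \<gamma> n" for n by (simp add: \<gamma>_def add_pos_nonneg)
  have \<gamma>_less: "\<gamma> m < \<gamma> n" if "n < m" for m n
  proof -
    have "q n < q m" using q(1) that by (simp add: strict_mono_less)
    then show ?thesis using q_gt[of n] q_gt[of m] by (simp add: \<gamma>_def frac_less2)
  qed
  then have \<gamma>_eq: "\<gamma> m = \<gamma> n \<longleftrightarrow> m = n" for m n by (metis less_irrefl linorder_neqE_nat)
  define g where "g n = enc (red p (monom 1 (\<gamma> n)))" for n
  have val_g: "val (g n) = of_rat (\<gamma> n)" for n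
    unfolding g_def val_enc using p_gt_1 \<gamma>_pos
    by (intro nrm_eqI) (auto simp: in_supp_iff coeff_red coeff_monom split: if_splits)
  have gc: "g n \<in> carrier k" for n using K_monom[OF \<gamma>_pos] by (simp add: g_def k_simps)
  define S where "S n = enc (red p (\<Sum>i\<le>n. monom 1 (\<gamma> i)))" for n
  have S0: "S 0 = g 0" by (simp add: S_def g_def)
  have SS: "S (Suc n) = S n \<oplus>\<^bsub>k\<^esub> g (Suc n)" for n by (simp add: S_def g_def k_simps red_simps)
  have SK: "red p (\<Sum>i\<le>n. monom 1 (\<gamma> i)) \<in> K" for n
  proof (induction n)
    case 0
    then show ?case by (simp add: K_monom \<gamma>_pos)
  next
    case (Suc n)
    from K_add[OF Suc K_monom[OF \<gamma>_pos, of 1 "Suc n"]] show ?case by (simp add: red_simps)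
  qed
  \<comment> \<open>The partial sum \<open>S n\<close> has coefficient 1 at \<gamma> n, and a
    distance below \<gamma> n forces w to share it. A pseudo-limit would therefore have every
    \<gamma> n in its support, against tameness.\<close>
  have no_limit: "\<exists>n. \<not> val (w \<ominus>\<^bsub>k\<^esub> S n) < val (g n)" if w: "w \<in> carrier k" for w
  proof (rule ccontr)
    assume *: "\<not> ?thesis"
    obtain y where y: "y \<in> K" "w = enc y" using w by (auto simp: k_simps)
    have "\<gamma> n \<in> supp y" for n
    proof -
      have "val (enc y \<ominus>\<^bsub>k\<^esub> S n) < of_rat (\<gamma> n)" using * y by (simp add: val_g)
      then have "coeff y (\<gamma> n) = coeff (red p (\<Sum>i\<le>n. monom 1 (\<gamma> i))) (\<gamma> n)"
        using val_diff_less_iff[OF y(1) SK, of "of_rat (\<gamma> n)" n] \<gamma>_pos[of n] by (simp add: S_def)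
      also have "\<dots> = (\<Sum>i\<le>n. if n = i then 1 else 0) mod int p"
        by (simp add: coeff_red coeff_sum coeff_monom \<gamma>_pos \<gamma>_eq)
      also have "\<dots> = 1" using p_gt_1 by simp
      finally show ?thesis by (simp add: in_supp_iff)
    qed
    then have "tame p (range \<gamma>)" using y(1) by (auto simp: K_def intro: tame_subset)
    moreover have "\<not> tame p (range \<gamma>)"
      unfolding \<gamma>_def[abs_def] using p_gt_1 q_prime q_gt q(1) by (intro not_tame_odd_primes) auto
    ultimately show False by blast
  qed
  show ?thesis
  proof (rule k.p_inv_linear_zero_if_spherically_complete_subspace[where \<phi> = \<psi> and \<delta> = \<delta> and B = B and L = "enc ` L" and g = g and S = S])
    show "0 < p" using p_gt_1 by simp
    show "enc ` L \<subseteq> carrier k" using L_subset_K by (auto simp: k_simps)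
    show "\<one>\<^bsub>k\<^esub> \<in> enc ` L"
      by (auto simp: k_simps L_def in_supp_iff coeff_1 split: if_splits intro!: exI[of _ 1])
    show "x \<oplus>\<^bsub>k\<^esub> y \<in> enc ` L" if xy: "x \<in> enc ` L" "y \<in> enc ` L" for x y
    proof -
      obtain a b where ab: "a \<in> L" "b \<in> L" "x = enc a" "y = enc b" using xy by blast
      have "supp (red p (a + b)) \<subseteq> supp a \<union> supp b"
        by (rule order_trans[OF supp_red]) (auto simp: in_supp_iff)
      then have "red p (a + b) \<in> L" using ab by (auto simp: L_def)
      then show ?thesis using ab by (simp add: k_simps)
    qed
    show "\<ominus>\<^bsub>k\<^esub> x \<in> enc ` L" if x: "x \<in> enc ` L" for x
    proof -
      obtain a where a: "a \<in> L" "x = enc a" using x by blast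
      have "supp (red p (- a)) \<subseteq> supp a"
        by (rule order_trans[OF supp_red]) (auto simp: in_supp_iff)
      then have "red p (- a) \<in> L" using a by (auto simp: L_def)
      moreover have "a \<in> K" using a L_subset_K by blast
      ultimately show ?thesis using a by (simp add: k_uminus)
    qed
    show "x [^]\<^bsub>k\<^esub> p \<otimes>\<^bsub>k\<^esub> y \<in> enc ` L" if x: "x \<in> carrier k" and y: "y \<in> enc ` L" for x y
    proof -
      obtain a b where ab: "x = enc a" "b \<in> L" "y = enc b" using x y by (auto simp: k_simps)
      \<comment> \<open>Modulo \<open>p\<close>, a \<open>p\<close>-th power is supported on
        \<open>p\<close>-th powers by \<open>supp_power_prime\<close>; so is \<open>b\<close>, and
        such exponents are closed under products.\<close>
      have "supp (red p (red p (a ^ p) * b)) \<subseteq> {s ^ p |s. 0 < s}"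
      proof
        fix q assume "q \<in> supp (red p (red p (a ^ p) * b))"
        then have "q \<in> supp_mult (red p (a ^ p)) b" using supp_red supp_mult_subset by blast
        then obtain c d where cd: "q = c * d" "c \<in> supp (red p (a ^ p))" "d \<in> supp b"
          by (auto simp: supp_mult_def)
        then have "\<not> int p dvd coeff (a ^ p) c" by (auto simp: in_supp_iff coeff_red)
        then obtain s where s: "0 < s" "c = s ^ p" using supp_power_prime[OF prime] by blast
        obtain t where "0 < t" "d = t ^ p" using cd(3) ab(2) by (auto simp: L_def)
        then have "q = (s * t) ^ p" "0 < s * t" using s cd by (auto simp: power_mult_distrib)
        then show "q \<in> {s ^ p |s. 0 < s}" by blast
      qed
      then have "red p (red p (a ^ p) * b) \<in> L" by (simp add: L_def)
      then show ?thesis by (simp add: ab k_pow k_simps)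
    qed
    show "\<exists>l\<in>enc ` L. \<forall>n. val (l \<ominus>\<^bsub>k\<^esub> X n) \<le> r n"
      if "\<And>n::nat. X n \<in> enc ` L" "\<And>n. 0 < r n" "\<And>m n. n \<le> m \<Longrightarrow> val (X m \<ominus>\<^bsub>k\<^esub> X n) \<le> r n" for X r
      by (rule L_spherically_complete) (use that in auto)
    show "0 < val (g n)" for n using \<gamma>_pos[of n] by (simp add: val_g)
    show "val (g (Suc n)) < val (g n)" for n using \<gamma>_less[of n "Suc n"] by (simp add: val_g of_rat_less)
  qed (use \<psi> \<delta> cont a val_dense gc S0 SS no_limit in auto)
qed

end

theorem theoremA:
  fixes p :: nat
  assumes "prime p"
  shows "\<exists>(R :: real set ring) (v :: real set \<Rightarrow> real).
           complete_nonarch_field R v \<and> ring_char_is R p \<and>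
           (\<forall>n::nat. n > 0 \<longrightarrow>
              (\<forall>\<phi>. p_inv_linear (tate R v n) p \<phi> \<longrightarrow>
                  (\<forall>x\<in>carrier (tate R v n). \<phi> x = \<zero>\<^bsub>tate R v n\<^esub>)) \<and>
              \<not> frobenius_split (tate R v n) p)"
proof -
  interpret hahn_mod p by unfold_locales (rule assms)
  have zero: "\<phi> x = \<zero>\<^bsub>tate k val n\<^esub>"
    if "0 < n" "p_inv_linear (tate k val n) p \<phi>" "x \<in> carrier (tate k val n)" for n \<phi> x
  proof -
    interpret tate_p_inv_linear k val p n \<phi> by unfold_locales (use that p_gt_1 in auto)
    show ?thesis
      by (rule p_inv_linear_tate_eq_zero[OF _ that(3)])
         (use continuous_p_inv_linear_k_eq_zero in blast)
  qed
  have "\<not> frobenius_split (tate k val n) p" if n: "0 < n" for n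
  proof
    assume "frobenius_split (tate k val n) p"
    then obtain \<phi> where \<phi>: "p_inv_linear (tate k val n) p \<phi>" "\<phi> \<one>\<^bsub>tate k val n\<^esub> = \<one>\<^bsub>tate k val n\<^esub>"
      unfolding frobenius_split_def by blast
    \<comment> \<open>A splitting would give 1 = \<phi>(1) = 0 in the Tate algebra, which the
      constant coefficient refutes.\<close>
    have one: "\<one>\<^bsub>tate k val n\<^esub> = k.tmonom \<one>\<^bsub>k\<^esub> (replicate n 0)"
      by (simp add: tate_def k.tmonom_def)
    then have "\<one>\<^bsub>tate k val n\<^esub> \<in> carrier (tate k val n)" by (simp add: k.tmonom_closed)
    then have "\<one>\<^bsub>tate k val n\<^esub> = \<zero>\<^bsub>tate k val n\<^esub>" using zero[OF n \<phi>(1)] \<phi>(2) by simp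
    then have "k.tmonom \<one>\<^bsub>k\<^esub> (replicate n 0) (replicate n 0) = \<zero>\<^bsub>k\<^esub>" by (simp add: one k.tate_zero)
    then show False by (simp add: k.tmonom_def)
  qed
  with zero show ?thesis using complete_nonarch_field_k ring_char_k by blast
qed

end
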